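(* Let $K\subseteq\mathbb{S}^n$ be a measurable set. Then there is a covering of $\mathbb{S}^n$ by rotated copies of $K$ of density at most $$\inf_{\delta}\left[\frac{\sigma(K)}{\sigma(K_{-\delta})}\left(1+\ln\frac{\sigma\left(K_{-\delta/2}\right)}{\Omega\left(\frac{\delta}{2}\right)}\right)\right],$$ where the infimum is taken over all $\delta>0$ with $\sigma(K_{-\delta})>0$ (and is $+\infty$, so that nothing is claimed, if there is no such $\delta$).
   Context: $\mathbb{S}^n$ is the unit sphere in $\mathbb{R}^{n+1}$ and $\sigma$ is the Haar (rotation invariant) probability measure on $\mathbb{S}^n$. $C(u,\phi)$ denotes the closed spherical cap of spherical (angular) radius $\phi$ centered at $u\in\mathbb{S}^n$, and $\Omega(\phi)=\sigma(C(u,\phi))$ denotes its measure. For $K\subset\mathbb{S}^n$ and $\delta>0$, the $\delta$-inner parallel body of $K$ is $K_{-\delta}=\{u\in K : C(u,\delta)\subseteq K\}$. A rotated copy of $K$ is a set $AK$ with $A\in SO(n+1)$. The density of a covering of $\mathbb{S}^n$ by $N$ rotated copies of $K$ is $N\sigma(K)$. *)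

theory Defs
  imports "HOL-Probability.Probability"
begin

text \<open>\<open>\<S>\<^sup>n\<close> is \<open>sphere 0 1\<close> in \<open>real ^ 'n\<close>, where \<open>CARD('n) = n + 1\<close>.\<close>

text \<open>\<open>\<sigma>\<close> is a rotation invariant probability measure on the Borel sets of the sphere. It exists
  (\<open>ex_haar_sphere\<close> below), and it is unique when \<open>CARD('n) \<ge> 2\<close>.\<close>
definition haar_sphere :: "(real ^ 'n) measure \<Rightarrow> bool" where
  "haar_sphere \<sigma> \<longleftrightarrow>
     prob_space \<sigma> \<and>
     sets \<sigma> = sets (restrict_space borel (sphere 0 1)) \<and>
     (\<forall>A. rotation_matrix A \<longrightarrow> distr \<sigma> \<sigma> ((*v) A) = \<sigma>)"

text \<open>For unit vectors the angular distance is \<open>arccos (u \<bullet> v)\<close>.\<close>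
definition cap :: "real ^ 'n \<Rightarrow> real \<Rightarrow> (real ^ 'n) set" where
  "cap u \<phi> = {v \<in> sphere 0 1. arccos (u \<bullet> v) \<le> \<phi>}"

text \<open>Sets are measured by the completion of \<open>\<sigma>\<close>. Borel measurability would not do: for a Borel
  set \<open>K\<close>, the set \<open>inner_parallel K \<delta>\<close> below is in general only coanalytic, but it always belongs
  to \<open>sets (completion \<sigma>)\<close>. The centre of the cap is irrelevant, see \<open>cap_measure_eq\<close>.\<close>
definition cap_measure :: "(real ^ 'n) measure \<Rightarrow> real \<Rightarrow> real" where
  "cap_measure \<sigma> \<phi> = measure (completion \<sigma>) (cap (SOME u. u \<in> sphere 0 1) \<phi>)"

definition inner_parallel :: "(real ^ 'n) set \<Rightarrow> real \<Rightarrow> (real ^ 'n) set" where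
  "inner_parallel K \<delta> = {u \<in> K. cap u \<delta> \<subseteq> K}"


lemma cap_in_sets:
  fixes u :: "real ^ 'n"
  assumes "haar_sphere \<sigma>" "u \<in> sphere 0 1"
  shows "cap u \<phi> \<in> sets \<sigma>"
proof -
  have "continuous_on (sphere 0 1) (\<lambda>v. arccos (u \<bullet> v))"
  proof (intro continuous_intros ballI conjI)
    fix v :: "real ^ 'n" assume "v \<in> sphere 0 1"
    then have "\<bar>u \<bullet> v\<bar> \<le> 1"
      using assms(2) Cauchy_Schwarz_ineq2[of u v] by simp
    then show "-1 \<le> u \<bullet> v" "u \<bullet> v \<le> 1" by auto
  qed
  then have "closed ((\<lambda>v. arccos (u \<bullet> v)) -` {..\<phi>} \<inter> sphere 0 1)"
    using continuous_on_closed_vimage[of "sphere 0 1 :: (real ^ 'n) set" "\<lambda>v. arccos (u \<bullet> v)"] by simp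
  moreover have "cap u \<phi> = (\<lambda>v. arccos (u \<bullet> v)) -` {..\<phi>} \<inter> sphere 0 1"
    by (auto simp: cap_def)
  ultimately have "cap u \<phi> \<in> sets borel" by simp
  moreover have "cap u \<phi> \<subseteq> sphere 0 1" by (auto simp: cap_def)
  ultimately show ?thesis
    using assms(1) by (auto simp: haar_sphere_def sets_restrict_space image_iff)
qed

lemma rotation_inner:
  fixes A :: "real ^ 'n ^ 'n"
  assumes "rotation_matrix A"
  shows "(A *v x) \<bullet> (A *v y) = x \<bullet> y"
proof -
  have "orthogonal_transformation ((*v) A)"
    using assms by (simp add: orthogonal_transformation_matrix rotation_matrix_def)
  then show ?thesis by (simp add: orthogonal_transformation_def)
qed

lemma cap_measure_eq:
  fixes \<sigma> :: "(real ^ 'n) measure"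
  assumes "haar_sphere \<sigma>" "2 \<le> CARD('n)" "u \<in> sphere 0 1"
  shows "cap_measure \<sigma> \<phi> = measure (completion \<sigma>) (cap u \<phi>)"
proof -
  define w :: "real ^ 'n" where "w = (SOME u. u \<in> sphere 0 1)"
  have w: "w \<in> sphere 0 1" unfolding w_def by (rule someI) (rule assms(3))
  obtain A k where A: "rotation_matrix A" "A *v w = u"
  proof -
    obtain B where B: "rotation_matrix B" "B *v axis undefined 1 = w"
      using rotation_matrix_exists_basis[OF assms(2), of w undefined] w by auto
    obtain C where C: "rotation_matrix C" "C *v axis undefined 1 = u"
      using rotation_matrix_exists_basis[OF assms(2), of u undefined] assms(3) by auto
    have "rotation_matrix (C ** transpose B)"
      using B C by (simp add: rotation_matrix_def orthogonal_matrix_mul det_mul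
          orthogonal_matrix_transpose)
    moreover have "(C ** transpose B) *v w = u"
      using B C by (metis matrix_vector_mul_assoc matrix_vector_mul_lid orthogonal_matrix_def
          rotation_matrix_def)
    ultimately show ?thesis using that by blast
  qed
  have sets: "sets \<sigma> = sets (restrict_space borel (sphere 0 1))"
    and inv: "distr \<sigma> \<sigma> ((*v) A) = \<sigma>"
    using assms(1) A by (auto simp: haar_sphere_def)
  have sp: "space \<sigma> = sphere 0 1"
    using sets_eq_imp_space_eq[OF sets] by (simp add: space_restrict_space)
  have norm: "norm (A *v x) = norm x" for x
    using rotation_inner[OF A(1), of x x] by (simp add: norm_eq_sqrt_inner)
  have "(*v) A \<in> measurable (restrict_space borel (sphere 0 1)) (restrict_space borel (sphere 0 1))"
    by (intro measurable_restrict_space3)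
      (auto simp: norm intro!: borel_measurable_continuous_onI linear_continuous_on
        matrix_vector_mul_bounded_linear)
  then have meas: "(*v) A \<in> measurable \<sigma> \<sigma>"
    by (simp add: measurable_cong_sets[OF sets sets])
  have "(*v) A -` cap u \<phi> \<inter> space \<sigma> = cap w \<phi>"
    using A by (auto simp: cap_def sp norm rotation_inner)
  then have "measure \<sigma> (cap u \<phi>) = measure \<sigma> (cap w \<phi>)"
    using measure_distr[OF meas cap_in_sets[OF assms(1,3)], of \<phi>] by (simp add: inv)
  then show ?thesis
    unfolding cap_measure_def w_def[symmetric] using cap_in_sets[OF assms(1)] assms(3) w by simp
qed

lemma distr_lborel_orthogonal:
  fixes f :: "'a::euclidean_space \<Rightarrow> 'a"
  assumes f: "orthogonal_transformation f"
  shows "distr lborel borel f = lborel"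
proof (rule lborel_eqI[symmetric])
  have lin: "linear f" using f by (rule orthogonal_transformation_linear)
  have [measurable]: "f \<in> borel_measurable borel"
    by (intro borel_measurable_continuous_onI linear_continuous_on linear_conv_bounded_linear[THEN iffD1] lin)
  have bij: "bij f" using f by (rule orthogonal_transformation_bij)
  fix l u :: 'a
  assume "\<And>b. b \<in> Basis \<Longrightarrow> l \<bullet> b \<le> u \<bullet> b"
  define U where "U = f -` box l u"
  have U: "open U"
    unfolding U_def by (intro open_vimage linear_continuous_on linear_conv_bounded_linear[THEN iffD1] lin) auto
  have fU: "f ` U = box l u" unfolding U_def by (simp add: bij bij_is_surj surj_image_vimage_eq)
  define K where "K = {(x, r). x \<in> U \<and> 0 < r \<and> r < 1 \<and> ball x r \<subseteq> U}"
  obtain C where C: "countable C" "C \<subseteq> K"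
      "pairwise (\<lambda>i j. disjnt (ball (fst i) (snd i)) (ball (fst j) (snd j))) C"
      "negligible (U - (\<Union>i\<in>C. ball (fst i) (snd i)))"
  proof (rule Vitali_covering_theorem_balls[of U K fst snd])
    fix x and d :: real assume "x \<in> U" "0 < d"
    obtain e where e: "0 < e" "ball x e \<subseteq> U" using U \<open>x \<in> U\<close> by (meson openE)
    have "(x, min (min d e) 1 / 2) \<in> K"
      using \<open>x \<in> U\<close> \<open>0 < d\<close> e by (auto simp: K_def subset_iff)
    then show "\<exists>i. i \<in> K \<and> x \<in> ball (fst i) (snd i) \<and> snd i < d"
      using \<open>0 < d\<close> e(1) by (intro exI[of _ "(x, min (min d e) 1 / 2)"]) auto
  qed blast
  define V where "V = (\<Union>i\<in>C. ball (fst i) (snd i))"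
  have "V \<subseteq> U" unfolding V_def
  proof (rule UN_least)
    fix i assume "i \<in> C"
    then have "i \<in> K" using C(2) by blast
    then show "ball (fst i) (snd i) \<subseteq> U" by (cases i) (simp add: K_def)
  qed
  have disj: "disjoint_family_on (\<lambda>i. ball (fst i) (snd i)) C"
    using C(3) by (auto simp: disjoint_family_on_def pairwise_def disjnt_def)
  have fV: "f ` V = (\<Union>i\<in>C. ball (f (fst i)) (snd i))"
    unfolding V_def image_UN by (simp add: image_orthogonal_transformation_ball[OF f])
  have disj': "disjoint_family_on (\<lambda>i. ball (f (fst i)) (snd i)) C"
    unfolding image_orthogonal_transformation_ball[OF f, symmetric]
    using disj unfolding disjoint_family_on_def
    by (simp add: image_Int[OF bij_is_inj[OF bij], symmetric])
  have ball: "emeasure lborel (ball (f x) r) = emeasure lborel (ball x r)" for x r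
    by (cases "r \<ge> 0") (simp_all add: emeasure_ball ball_empty)
  have eqV: "emeasure lborel (f ` V) = emeasure lborel V"
    unfolding fV unfolding V_def
    using C(1) disj disj' by (simp add: emeasure_UN_countable ball)
  have "open V" unfolding V_def by auto
  have "open (f ` V)" unfolding fV by auto
  have null: "emeasure lborel B = emeasure lborel A"
    if "open A" "open B" "A \<subseteq> B" "negligible (B - A)" for A B :: "'a set"
  proof -
    have "B - A \<in> null_sets lborel"
      using that by (simp add: negligible_iff_null_sets null_sets_completion_iff)
    moreover have "B = A \<union> (B - A)" using that by auto
    ultimately show ?thesis using that by (metis emeasure_Un_null_set borel_open sets_lborel)
  qed
  have "f ` U - f ` V = f ` (U - V)" using bij by (simp add: bij_def image_set_diff)
  then have "negligible (f ` U - f ` V)"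
    using C(4) linear_imp_differentiable_on[OF lin]
    by (simp add: V_def negligible_differentiable_image_negligible)
  then have "emeasure lborel (f ` U) = emeasure lborel (f ` V)"
    using \<open>open (f ` V)\<close> image_mono[OF \<open>V \<subseteq> U\<close>, of f] by (intro null) (simp_all add: fU open_box)
  also have "\<dots> = emeasure lborel U"
    using eqV null[OF \<open>open V\<close> U \<open>V \<subseteq> U\<close>] C(4) by (simp add: V_def)
  finally show "emeasure (distr lborel borel f) (box l u) = (\<Prod>b\<in>Basis. (u - l) \<bullet> b)"
    using \<open>\<And>b. b \<in> Basis \<Longrightarrow> l \<bullet> b \<le> u \<bullet> b\<close>
    by (simp add: emeasure_distr U_def[symmetric] fU)
qed simp

lemma ex_haar_sphere: "\<exists>\<sigma> :: (real ^ 'n) measure. haar_sphere \<sigma>"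
proof -
  define e :: "real ^ 'n" where "e = axis undefined 1"
  define B :: "(real ^ 'n) set" where "B = ball 0 1 - {0}"
  define p :: "real ^ 'n \<Rightarrow> real ^ 'n" where "p = (\<lambda>x. if x \<in> B then x /\<^sub>R norm x else e)"
  let ?S = "restrict_space borel (sphere 0 1 :: (real ^ 'n) set)"
  let ?U = "uniform_measure lborel B"
  have [measurable]: "B \<in> sets borel" by (simp add: B_def)
  have e: "norm e = 1" by (simp add: e_def)
  have "emeasure lborel B = emeasure lborel (ball 0 1 :: (real ^ 'n) set)"
    unfolding B_def by (intro emeasure_Diff_null_set) auto
  then have B: "emeasure lborel B \<noteq> 0" "emeasure lborel B \<noteq> \<infinity>"
    using unit_ball_vol_pos[of "real CARD('n)"] by (simp_all add: emeasure_ball del: unit_ball_vol_pos)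
  interpret U: prob_space ?U by (rule prob_space_uniform_measure[OF B])
  have p: "p \<in> measurable ?U ?S"
    by (rule measurable_restrict_space2) (auto simp: p_def B_def e)
  have "distr (distr ?U ?S p) (distr ?U ?S p) ((*v) A) = distr ?U ?S p"
    if A: "rotation_matrix A" for A
  proof -
    have norm: "norm (A *v x) = norm x" for x
      using rotation_inner[OF A, of x x] by (simp add: norm_eq_sqrt_inner)
    have f: "orthogonal_transformation ((*v) A)"
      by (simp add: orthogonal_transformation_def rotation_inner A matrix_vector_mul_linear)
    have [measurable]: "(*v) A \<in> borel_measurable borel"
      by (intro borel_measurable_continuous_onI linear_continuous_on
        matrix_vector_mul_bounded_linear)
    have AS: "(*v) A \<in> measurable ?S ?S"
      by (intro measurable_restrict_space3) (auto simp: norm)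
    have inv: "distr ?U borel ((*v) A) = ?U"
    proof (rule measure_eqI)
      fix X assume "X \<in> sets (distr ?U borel ((*v) A))"
      then have [measurable]: "X \<in> sets borel" by simp
      have "B \<inter> (*v) A -` X = (*v) A -` (B \<inter> X)"
        by (auto simp: B_def norm) (metis norm norm_eq_zero)+
      moreover have "emeasure lborel ((*v) A -` (B \<inter> X)) = emeasure lborel (B \<inter> X)"
        by (subst (2) distr_lborel_orthogonal[OF f, symmetric]) (simp add: emeasure_distr)
      ultimately show "emeasure (distr ?U borel ((*v) A)) X = emeasure ?U X"
        using measurable_sets_borel[of "(*v) A" borel X] by (simp add: emeasure_distr)
    qed simp
    have "distr (distr ?U ?S p) ?S ((*v) A) = distr ?U ?S ((*v) A \<circ> p)"
      by (rule distr_distr[OF AS p])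
    also have "\<dots> = distr ?U ?S (p \<circ> (*v) A)"
    proof (rule distr_cong_AE)
      have "A *v p x = p (A *v x)" if "x \<in> B" for x
      proof -
        have "A *v x \<in> B" using that norm[of x] by (auto simp: B_def)
        then show ?thesis using that by (simp add: p_def norm matrix_vector_mult_scaleR)
      qed
      then show "AE x in ?U. ((*v) A \<circ> p) x = (p \<circ> (*v) A) x"
        by (intro AE_uniform_measureI) auto
      show "(*v) A \<circ> p \<in> measurable ?U ?S" by (rule measurable_comp[OF p AS])
      show "p \<circ> (*v) A \<in> measurable ?U ?S"
        by (rule measurable_comp[OF _ p]) simp
    qed auto
    also have "\<dots> = distr (distr ?U borel ((*v) A)) ?S p"
      using p by (subst distr_distr) (auto cong: measurable_cong_sets)
    also have "\<dots> = distr ?U ?S p" by (simp add: inv)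
    finally show ?thesis by (simp cong: distr_cong)
  qed
  then have "haar_sphere (distr ?U ?S p)"
    by (simp add: haar_sphere_def U.prob_space_distr[OF p])
  then show ?thesis by blast
qed

end

theory Submission
  imports Defs
begin

text \<open>
  Fix \<open>\<delta>\<close>. Choose a finite set \<open>V\<close> of points on the sphere whose caps of radius \<open>\<delta> / 2\<close> are disjoint,
  with \<open>V\<close> maximal. By the triangle inequality every point of the sphere has angle at most \<open>\<delta>\<close> to
  some point of \<open>V\<close>, so it is enough to cover the finite set \<open>V\<close> by rotated copies of the inner
  parallel body \<open>inner_parallel K \<delta>\<close>: enlarging them to copies of \<open>K\<close> covers the sphere.

  Let \<open>p\<close> be the measure of this body. A random rotation moves each point of \<open>V\<close> into it with
  probability \<open>p\<close>, so among any \<open>k\<close> points of \<open>V\<close> some copy covers at least \<open>p * k\<close>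
  (\<open>rotation_hits_many\<close>). On the other hand, a copy that contains \<open>m\<close> points of \<open>V\<close> has room for \<open>m\<close>
  disjoint caps of radius \<open>\<delta> / 2\<close> in the copy of \<open>inner_parallel K (\<delta> / 2)\<close>, which bounds \<open>m\<close> by the
  quotient \<open>q\<close> inside the logarithm. The greedy algorithm (\<open>greedy_cover\<close>) therefore needs at most
  \<open>(1 + ln q) / p\<close> copies.

  Two points of measure theory remain. A random rotation is needed that moves
  every point to a \<open>\<sigma>\<close>-distributed one; it is obtained by orthonormalizing the rows of a random matrix
  (\<open>ex_invariant_rotation_measure\<close>), and \<open>\<sigma>\<close> enters by Fubini (\<open>measure_rotations_into\<close>).
  And the inner parallel bodies of a measurable set must be measurable
  (\<open>inner_parallel_in_sets\<close>): removing the open caps around the complement of \<open>K\<close> is harmless, and the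
  part reached by the closed caps only is porous, hence null (\<open>porous_null\<close>).
\<close>

section \<open>Covering a finite set greedily\<close>

text \<open>The greedy estimate of Lovasz and Stein. If every subset of \<open>V\<close> has a fraction at least \<open>p\<close>
  of its points in a single set \<open>S i\<close>, then \<open>1 / p\<close> bounds the fractional covering number, and always taking a set that
  hits the most uncovered points loses only a factor \<open>1 + ln D\<close>. The bound \<open>|V| / D + ln D / p\<close> is
  the potential that makes the induction close: a set with \<open>D\<close> new points lowers the first term by
  one, and if no such set is left, then \<open>p |V| \<le> D - 1\<close>, so that lowering \<open>D\<close> by one does not
  increase the potential, because \<open>ln D - ln (D - 1) \<ge> 1 / D\<close>.\<close>
lemma greedy_cover:
  fixes S :: "'i \<Rightarrow> 'a set" and p :: real and D :: nat
  assumes p: "0 < p"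
    and avg: "\<And>W. finite W \<Longrightarrow> W \<noteq> {} \<Longrightarrow> W \<subseteq> V \<Longrightarrow> \<exists>i\<in>I. p * card W \<le> card (W \<inter> S i)"
    and "finite V" "\<And>i. i \<in> I \<Longrightarrow> card (V \<inter> S i) \<le> D" "0 < D"
  shows "\<exists>J. finite J \<and> J \<subseteq> I \<and> V \<subseteq> (\<Union>i\<in>J. S i) \<and> card J \<le> card V / D + ln D / p"
  using avg assms(3-5)
proof (induction "card V + D" arbitrary: V D rule: less_induct)
  case less
  note avg = less.prems(1) and fin = less.prems(2) and D = less.prems(3,4)
  show ?case
  proof (cases "V = {}")
    case True
    then show ?thesis using D p by (intro exI[of _ "{}"]) auto
  next
    case False
    show ?thesis
    proof (cases "\<exists>i\<in>I. card (V \<inter> S i) = D")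
      case True
      then obtain i where i: "i \<in> I" "card (V \<inter> S i) = D" by blast
      define W where "W = V - S i"
      have V: "card V = card W + D"
        using card_Int_Diff[OF fin, of "S i"] i(2) by (simp add: W_def)
      have "\<exists>J. finite J \<and> J \<subseteq> I \<and> W \<subseteq> (\<Union>i\<in>J. S i) \<and> card J \<le> card W / D + ln D / p"
      proof (rule less.hyps)
        show "card W + D < card V + D" using V D by simp
        show "finite W" using fin by (simp add: W_def)
        show "\<exists>i\<in>I. p * card X \<le> card (X \<inter> S i)" if "finite X" "X \<noteq> {}" "X \<subseteq> W" for X
          using that avg[of X] by (auto simp: W_def)
        show "card (W \<inter> S j) \<le> D" if "j \<in> I" for j
          using card_mono[of "V \<inter> S j" "W \<inter> S j"] fin D(1)[OF that] by (force simp: W_def)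
      qed (use D in auto)
      then obtain J where J: "finite J" "J \<subseteq> I" "W \<subseteq> (\<Union>i\<in>J. S i)" "card J \<le> card W / D + ln D / p"
        by blast
      have "real (card (insert i J)) \<le> card V / D + ln D / p"
        using J(1,4) D(2) card_insert_le_m1[of "Suc (card J)" J i]
        by (simp add: V add_divide_distrib card_insert_if)
      moreover have "V \<subseteq> (\<Union>j\<in>insert i J. S j)" using J(3) by (auto simp: W_def)
      ultimately show ?thesis using J i by (intro exI[of _ "insert i J"]) auto
    next
      case no: False
      have lt: "card (V \<inter> S i) \<le> D - 1" if "i \<in> I" for i
        using no that D(1)[OF that] by fastforce
      obtain i where i: "i \<in> I" "p * card V \<le> card (V \<inter> S i)"
        using avg[of V] fin False by auto
      have pV: "p * card V \<le> real (D - 1)" using i lt[OF i(1)] by linarith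
      have "0 < p * card V" using p fin False by (simp add: card_gt_0_iff)
      then have D2: "0 < D - 1" using pV by (cases "D - 1") auto
      have "\<exists>J. finite J \<and> J \<subseteq> I \<and> V \<subseteq> (\<Union>i\<in>J. S i) \<and> card J \<le> card V / real (D - 1) + ln (D - 1) / p"
        by (rule less.hyps) (use D2 D lt avg fin in auto)
      then obtain J where J: "finite J" "J \<subseteq> I" "V \<subseteq> (\<Union>i\<in>J. S i)"
          "card J \<le> card V / real (D - 1) + ln (D - 1) / p" by blast
      define d where "d = real (D - 1)"
      have d: "0 < d" "real D = d + 1" using D2 by (auto simp: d_def)
      have "ln (d / (d + 1)) \<le> d / (d + 1) - 1" using d by (intro ln_le_minus_one) auto
      then have "ln d + 1 / (d + 1) \<le> ln (d + 1)" using d by (simp add: ln_div field_simps)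
      then have 1: "(ln d + 1 / (d + 1)) / p \<le> ln (d + 1) / p" using p by (simp add: divide_right_mono)
      have "card V / d - card V / (d + 1) = card V / (d * (d + 1))"
        using d(1) by (simp add: diff_frac_eq add_pos_pos[of d 1, THEN less_imp_neq, symmetric] algebra_simps)
      also have "\<dots> = (p * card V) / (p * (d * (d + 1)))" using p by simp
      also have "\<dots> \<le> d / (p * (d * (d + 1)))"
        using pV d(1) p by (intro divide_right_mono) (auto simp: d_def)
      also have "\<dots> = (1 / (d + 1)) / p" using d(1) p by simp
      finally have "card V / d + ln d / p \<le> card V / (d + 1) + ln (d + 1) / p"
        using 1 by (simp add: add_divide_distrib)
      then show ?thesis using J by (intro exI[of _ J]) (auto simp: d_def d(2))
    qed
  qed
qed

section \<open>Maximal disjoint families\<close>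

text \<open>Disjoint events of probability at least \<open>c\<close> number at most \<open>1 / c\<close>, so a disjoint family of
  largest cardinality exists, and it cannot be extended. With caps or balls for \<open>B\<close>, this yields
  nets whose small balls are disjoint while the balls of twice the radius cover.\<close>
lemma (in prob_space) finite_maximal_disjoint:
  assumes c: "0 < c" and B: "\<And>x. x \<in> Y \<Longrightarrow> B x \<in> events" "\<And>x. x \<in> Y \<Longrightarrow> c \<le> prob (B x)"
  shows "\<exists>V\<subseteq>Y. finite V \<and> disjoint_family_on B V \<and> (\<forall>x\<in>Y. \<exists>v\<in>V. B x \<inter> B v \<noteq> {})"
proof -
  define P where "P V \<longleftrightarrow> V \<subseteq> Y \<and> finite V \<and> disjoint_family_on B V" for V
  have bound: "card V \<le> nat \<lceil>1 / c\<rceil>" if "P V" for V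
  proof -
    have "card V * c \<le> (\<Sum>v\<in>V. prob (B v))"
      using B that by (intro sum_bounded_below) (auto simp: P_def)
    also have "\<dots> = prob (\<Union>v\<in>V. B v)"
      using B that by (intro finite_measure_finite_Union[symmetric]) (auto simp: P_def)
    finally have "card V * c \<le> 1" using prob_le_1[of "\<Union>v\<in>V. B v"] by linarith
    then have "real (card V) \<le> 1 / c" using c by (simp add: field_simps)
    then show ?thesis by linarith
  qed
  have "P {}" by (simp add: P_def disjoint_family_on_def)
  then obtain V where V: "P V" "\<And>W. P W \<Longrightarrow> card W \<le> card V"
    using ex_has_greatest_nat[of P "{}" card "nat \<lceil>1 / c\<rceil> + 1"] bound by (auto simp: less_Suc_eq_le)
  have "\<exists>v\<in>V. B x \<inter> B v \<noteq> {}" if x: "x \<in> Y" for x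
  proof (rule ccontr)
    assume no: "\<not> ?thesis"
    have "B x \<noteq> {}" using B(2)[OF x] c by auto
    then have "x \<notin> V" using no by auto
    moreover have "P (insert x V)"
      using V(1) x no by (auto simp: P_def disjoint_family_on_def)
    ultimately show False using V(2)[of "insert x V"] V(1) by (simp add: P_def)
  qed
  then show ?thesis using V(1) by (auto simp: P_def)
qed

section \<open>The angular metric\<close>

text \<open>Split \<open>x\<close> and \<open>z\<close> into components along and orthogonal to \<open>y\<close>. For the angles \<open>a\<close> and \<open>b\<close>, the
  orthogonal parts have lengths \<open>sin a\<close> and \<open>sin b\<close>, so Cauchy-Schwarz gives
  \<open>x \<bullet> z \<ge> cos a * cos b - sin a * sin b = cos (a + b)\<close>.\<close>
lemma arccos_inner_triangle:
  fixes x y z :: "'a::real_inner"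
  assumes "norm x = 1" "norm y = 1" "norm z = 1"
  shows "arccos (x \<bullet> z) \<le> arccos (x \<bullet> y) + arccos (y \<bullet> z)"
proof -
  have bd: "\<bar>u \<bullet> v\<bar> \<le> 1" if "norm u = 1" "norm v = 1" for u v :: 'a
    using Cauchy_Schwarz_ineq2[of u v] that by simp
  define a b where "a = arccos (x \<bullet> y)" and "b = arccos (y \<bullet> z)"
  have a: "0 \<le> a" "a \<le> pi" "cos a = x \<bullet> y" and b: "0 \<le> b" "b \<le> pi" "cos b = y \<bullet> z"
    using bd[OF assms(1,2)] bd[OF assms(2,3)] by (auto simp: a_def b_def arccos_lbound arccos_ubound cos_arccos_abs abs_le_iff)
  have n: "norm (u - (u \<bullet> y) *\<^sub>R y) = sin t" if "norm u = 1" "cos t = u \<bullet> y" "0 \<le> t" "t \<le> pi" for u t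
  proof -
    have "(norm (u - (u \<bullet> y) *\<^sub>R y))\<^sup>2 = 1 - (cos t)\<^sup>2"
      using that(1,2) assms(2) unfolding power2_norm_eq_inner norm_eq_1
      by (simp add: inner_diff_left inner_diff_right inner_commute power2_eq_square)
    also have "\<dots> = (sin t)\<^sup>2" by (simp add: sin_squared_eq)
    finally show ?thesis using sin_ge_zero[of t] that by (simp add: power2_eq_iff_nonneg)
  qed
  have "x \<bullet> z = cos a * cos b + (x - (x \<bullet> y) *\<^sub>R y) \<bullet> (z - (z \<bullet> y) *\<^sub>R y)"
    using assms(2) by (simp add: a b inner_diff_left inner_diff_right inner_commute flip: norm_eq_1)
  moreover have "\<bar>(x - (x \<bullet> y) *\<^sub>R y) \<bullet> (z - (z \<bullet> y) *\<^sub>R y)\<bar> \<le> sin a * sin b"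
    using Cauchy_Schwarz_ineq2[of "x - (x \<bullet> y) *\<^sub>R y" "z - (z \<bullet> y) *\<^sub>R y"] n[of x a] n[of z b] a b assms
    by (simp add: inner_commute)
  ultimately have c: "cos (a + b) \<le> x \<bullet> z" by (simp add: cos_add)
  have "arccos (x \<bullet> z) \<le> a + b"
  proof (cases "a + b \<le> pi")
    case True
    then have "arccos (x \<bullet> z) \<le> arccos (cos (a + b))"
      using c bd[OF assms(1,3)] by (intro arccos_le_arccos) (auto simp: abs_le_iff)
    then show ?thesis using True a b by (simp add: arccos_cos)
  next
    case False
    then show ?thesis using bd[OF assms(1,3)] arccos_ubound[of "x \<bullet> z"] by (simp add: abs_le_iff)
  qed
  then show ?thesis by (simp add: a_def b_def)
qed

lemma dist_unit_vectors:
  fixes x y :: "'a::real_inner"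
  assumes "norm x = 1" "norm y = 1"
  shows "(dist x y)\<^sup>2 = 2 - 2 * (x \<bullet> y)"
  using assms unfolding dist_norm power2_norm_eq_inner norm_eq_1
  by (simp add: inner_diff_left inner_diff_right inner_commute)

text \<open>The chord of an angle \<open>t\<close> is \<open>2 * sin (t / 2)\<close>. The constant 2 comes from
  the crude estimate \<open>sin s \<ge> s - s ^ 3 / 6 \<ge> s / 2\<close>, valid for \<open>s \<le> pi / 2 < sqrt 3\<close>.\<close>
lemma arccos_inner_le_dist:
  fixes x y :: "'a::real_inner"
  assumes "norm x = 1" "norm y = 1"
  shows "arccos (x \<bullet> y) \<le> 2 * dist x y"
proof -
  define t where "t = arccos (x \<bullet> y)"
  have "\<bar>x \<bullet> y\<bar> \<le> 1" using Cauchy_Schwarz_ineq2[of x y] assms by simp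
  then have t: "0 \<le> t" "t \<le> pi" "cos t = x \<bullet> y"
    by (auto simp: t_def arccos_lbound arccos_ubound cos_arccos_abs abs_le_iff)
  have "(dist x y)\<^sup>2 = 2 - 2 * cos t"
    using dist_unit_vectors[OF assms] by (simp add: t)
  also have "\<dots> = (2 * sin (t / 2))\<^sup>2"
    using cos_double_sin[of "t/2"] by (simp add: power_mult_distrib)
  finally have d: "dist x y = 2 * sin (t / 2)"
    using t sin_ge_zero[of "t/2"] by (subst (asm) power2_eq_iff_nonneg) auto
  define s where "s = t / 2"
  have s: "0 \<le> s" "s \<le> 1.6" using t pi_approx by (auto simp: s_def)
  have "\<bar>sin s - s\<bar> \<le> s ^ 3 / 6"
    using Maclaurin_sin_bound[of s 3] s by (simp add: numeral_eq_Suc sin_coeff_def fact_numeral field_simps)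
  moreover have "s ^ 3 \<le> 3 * s"
  proof -
    have "s * s \<le> 1.6 * 1.6" using s by (intro mult_mono) auto
    then have "s * (s * s) \<le> s * 3" using s by (intro mult_left_mono) auto
    then show ?thesis by (simp add: power3_eq_cube mult_ac)
  qed
  ultimately have "s / 2 \<le> sin s" by linarith
  then show ?thesis using d by (simp add: s_def t_def)
qed

text \<open>The point at angle \<open>t\<close> from \<open>x\<close> on the great circle arc to \<open>v\<close>. The bounds on the angle exclude
  \<open>v = x\<close> and \<open>v = -x\<close>, where the arc is degenerate or not unique.\<close>
lemma geodesic_point:
  fixes x v :: "'a::real_inner"
  assumes "norm x = 1" "norm v = 1" "0 < arccos (x \<bullet> v)" "arccos (x \<bullet> v) < pi"
    "0 \<le> t" "t \<le> arccos (x \<bullet> v)"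
  obtains y where "norm y = 1" "dist x y \<le> t" "arccos (y \<bullet> v) = arccos (x \<bullet> v) - t"
proof -
  define a where "a = arccos (x \<bullet> v)"
  have "\<bar>x \<bullet> v\<bar> \<le> 1" using Cauchy_Schwarz_ineq2[of x v] assms by simp
  then have ca: "cos a = x \<bullet> v" by (simp add: a_def cos_arccos_abs)
  have a: "0 < a" "a < pi" "t \<le> a" using assms by (auto simp: a_def)
  then have sa: "0 < sin a" by (intro sin_gt_zero)
  have sa2: "sin a * sin a = 1 - cos a * cos a"
    using sin_squared_eq[of a] by (simp add: power2_eq_square)
  define e where "e = (1 / sin a) *\<^sub>R (v - cos a *\<^sub>R x)"
  have xx: "x \<bullet> x = 1" and vv: "v \<bullet> v = 1" using assms by (simp_all add: norm_eq_1)
  have ee: "e \<bullet> e = 1"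
    using sa sa2 by (simp add: e_def inner_diff_left inner_diff_right xx vv ca inner_commute field_simps)
  have xe: "x \<bullet> e = 0"
    by (simp add: e_def inner_diff_left inner_diff_right xx vv ca inner_commute)
  have ev: "e \<bullet> v = sin a"
    using sa sa2 by (simp add: e_def inner_diff_left inner_diff_right xx vv ca inner_commute field_simps)
  define y where "y = cos t *\<^sub>R x + sin t *\<^sub>R e"
  have ny: "norm y = 1"
    using xe sin_cos_squared_add[of t] unfolding norm_eq_1
    by (simp add: y_def inner_add_left inner_add_right xx ee inner_commute power2_eq_square)
  have "(dist x y)\<^sup>2 = 2 - 2 * (x \<bullet> y)"
    using dist_unit_vectors[OF assms(1) ny] .
  also have "\<dots> = (2 * sin (t / 2))\<^sup>2"
    using cos_double_sin[of "t/2"] by (simp add: y_def inner_add_right xx xe power_mult_distrib)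
  also have "\<dots> \<le> t\<^sup>2"
  proof -
    have "\<bar>sin (t / 2)\<bar> \<le> \<bar>t / 2\<bar>" by (rule abs_sin_x_le_abs_x)
    then have "\<bar>2 * sin (t / 2)\<bar> \<le> \<bar>t\<bar>" by simp
    then show ?thesis by (simp only: abs_le_square_iff)
  qed
  finally have "dist x y \<le> t" using assms(5) by (simp add: power2_le_iff_abs_le)
  moreover have "y \<bullet> v = cos (a - t)"
    by (simp add: y_def inner_add_left ev flip: ca) (simp add: cos_diff)
  then have "arccos (y \<bullet> v) = a - t" using a assms(5) by (simp add: arccos_cos)
  ultimately show ?thesis using that[of y] ny by (simp add: a_def)
qed

section \<open>An equivariant map from invertible matrices to rotations\<close>

text \<open>Since \<open>sgn 0 = 0\<close>, the recursion makes sense for dependent vectors as well, where it returns zero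
  vectors. So the result is orthogonal and depends measurably on the input without exceptions.\<close>
fun gram_schmidt :: "(nat \<Rightarrow> 'a::real_inner) \<Rightarrow> nat \<Rightarrow> 'a" where
  "gram_schmidt c i = sgn (c i - (\<Sum>j<i. (c i \<bullet> gram_schmidt c j) *\<^sub>R gram_schmidt c j))"

declare gram_schmidt.simps [simp del]

lemma gram_schmidt_orthogonal_transformation:
  assumes "orthogonal_transformation f"
  shows "gram_schmidt (\<lambda>i. f (c i)) i = f (gram_schmidt c i)"
proof (induction i rule: less_induct)
  case (less i)
  have lin: "linear f" and inn: "\<And>x y. f x \<bullet> f y = x \<bullet> y" and n: "\<And>x. norm (f x) = norm x"
    using assms by (auto simp: orthogonal_transformation_def orthogonal_transformation_norm)
  have "f (c i) - (\<Sum>j<i. (c i \<bullet> gram_schmidt c j) *\<^sub>R f (gram_schmidt c j)) =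
      f (c i - (\<Sum>j<i. (c i \<bullet> gram_schmidt c j) *\<^sub>R gram_schmidt c j))"
    by (simp add: linear_diff[OF lin] linear_sum[OF lin] linear_scale[OF lin])
  moreover have "sgn (f x) = f (sgn x)" for x
    by (simp add: sgn_div_norm n linear_scale[OF lin])
  ultimately show ?case
    by (subst (1 2) gram_schmidt.simps) (simp add: less inn)
qed

lemma gram_schmidt_orthogonal:
  assumes "k < i"
  shows "gram_schmidt c i \<bullet> gram_schmidt c k = 0"
  using assms
proof (induction i arbitrary: k rule: less_induct)
  case (less i)
  let ?q = "gram_schmidt c"
  have *: "?q j \<bullet> ?q k = 0" if "j < i" "j \<noteq> k" for j
    using less that by (metis inner_commute linorder_neqE_nat)
  obtain w where "?q k = sgn w" using gram_schmidt.simps[of c k] by blast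
  then have "?q k = 0 \<or> ?q k \<bullet> ?q k = 1" by (simp add: dot_square_norm norm_sgn)
  then have "(c i \<bullet> ?q k) * (?q k \<bullet> ?q k) = c i \<bullet> ?q k" by auto
  moreover have "(\<Sum>j<i. (c i \<bullet> ?q j) * (?q j \<bullet> ?q k)) =
      (\<Sum>j<i. if j = k then (c i \<bullet> ?q k) * (?q k \<bullet> ?q k) else 0)"
    using * by (intro sum.cong) auto
  ultimately have "(c i - (\<Sum>j<i. (c i \<bullet> ?q j) *\<^sub>R ?q j)) \<bullet> ?q k = 0"
    using less.prems by (simp add: inner_diff_left inner_sum_left)
  then show ?case
    by (subst gram_schmidt.simps) (simp add: sgn_div_norm)
qed

lemma gram_schmidt_in_span: "gram_schmidt c i \<in> span (c ` {..i})"
proof (induction i rule: less_induct)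
  case (less i)
  have "gram_schmidt c j \<in> span (c ` {..i})" if "j < i" for j
    using less[OF that] that span_mono[of "c ` {..j}" "c ` {..i}"] by fastforce
  then show ?case
    by (subst gram_schmidt.simps)
      (auto simp: sgn_div_norm intro!: span_scale span_diff span_sum intro: span_base)
qed

lemma norm_gram_schmidt:
  assumes "c i \<notin> span (c ` {..<i})"
  shows "norm (gram_schmidt c i) = 1"
proof -
  have "gram_schmidt c j \<in> span (c ` {..<i})" if "j < i" for j
    using gram_schmidt_in_span[of c j] that span_mono[of "c ` {..j}" "c ` {..<i}"] by fastforce
  then have "(\<Sum>j<i. (c i \<bullet> gram_schmidt c j) *\<^sub>R gram_schmidt c j) \<in> span (c ` {..<i})"
    by (intro span_sum span_scale) auto
  then show ?thesis using assms
    by (subst gram_schmidt.simps) (auto simp: norm_sgn)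
qed

lemma measurable_gram_schmidt:
  fixes c :: "nat \<Rightarrow> 'b \<Rightarrow> 'a::euclidean_space"
  assumes [measurable]: "\<And>i. c i \<in> borel_measurable M"
  shows "(\<lambda>x. gram_schmidt (\<lambda>i. c i x) i) \<in> borel_measurable M"
proof (induction i rule: less_induct)
  case (less i)
  have [measurable]: "(\<lambda>x. gram_schmidt (\<lambda>i. c i x) j) \<in> borel_measurable M" if "j \<in> {..<i}" for j
    using less that by simp
  show ?case
    by (subst gram_schmidt.simps) measurable
qed

lemma row_eq_nth: "row i A = A $ i"
  by (simp add: row_def vec_eq_iff)

text \<open>Subtracting from row \<open>i\<close> a combination of other rows does not change the determinant; if it made
  the row vanish, the determinant would be 0.\<close>
lemma row_notin_span:
  fixes G :: "real^'n^'n"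
  assumes "det G \<noteq> 0" "i \<notin> J"
  shows "G $ i \<notin> span ((\<lambda>j. G $ j) ` J)"
proof
  assume "G $ i \<in> span ((\<lambda>j. G $ j) ` J)"
  moreover have "(\<lambda>j. G $ j) ` J \<subseteq> {row j G |j. j \<noteq> i}"
    using assms(2) by (auto simp: row_eq_nth)
  ultimately have "- row i G \<in> span {row j G |j. j \<noteq> i}"
    using span_mono[of "(\<lambda>j. G $ j) ` J" "{row j G |j. j \<noteq> i}"]
    by (auto simp: row_eq_nth intro!: span_neg)
  then have "det (\<chi> k. if k = i then row i G + - row i G else row k G) = det G"
    by (intro det_row_span) (simp add: span_vec_eq)
  moreover have "det (\<chi> k. if k = i then row i G + - row i G else row k G) = 0"
    by (rule det_zero_row(1)[of i]) (simp add: row_def vec_eq_iff)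
  ultimately show False using assms(1) by simp
qed

abbreviation index_of :: "'n::finite \<Rightarrow> nat" where
  "index_of \<equiv> to_nat_on UNIV"

abbreviation nth_index :: "nat \<Rightarrow> 'n::finite" where
  "nth_index \<equiv> from_nat_into UNIV"

definition orthonormalize_rows :: "real^'n^'n \<Rightarrow> real^'n^'n" where
  "orthonormalize_rows G =
    (\<chi> i. gram_schmidt (\<lambda>k. G $ nth_index k) (index_of i))"

text \<open>One row is multiplied by the determinant \<open>\<plusminus>1\<close> of the orthonormalized matrix. This turns it into
  a rotation and respects multiplication by rotations, which leave the determinant unchanged.\<close>
definition rotation_of :: "real^'n^'n \<Rightarrow> real^'n^'n" where
  "rotation_of G =
    (\<chi> i. (if i = nth_index 0 then det (orthonormalize_rows G) else 1) *\<^sub>R orthonormalize_rows G $ i)"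

lemma orthogonal_matrix_orthonormalize_rows:
  fixes G :: "real^'n^'n"
  assumes "det G \<noteq> 0"
  shows "orthogonal_matrix (orthonormalize_rows G)"
proof -
  let ?c = "\<lambda>k. G $ nth_index k"
  have "norm (gram_schmidt ?c (index_of i)) = 1" for i :: 'n
  proof (rule norm_gram_schmidt)
    have "i \<notin> nth_index ` {..<index_of i}"
    proof
      assume "i \<in> nth_index ` {..<index_of i}"
      then obtain k where k: "k < index_of i" "i = nth_index k" by auto
      moreover have "index_of i < CARD('n)"
        using to_nat_on_finite[of "UNIV :: 'n set"] by (auto simp: bij_betw_def)
      ultimately have "k \<in> range (index_of :: 'n \<Rightarrow> nat)"
        using to_nat_on_finite[of "UNIV :: 'n set"] by (auto simp: bij_betw_def)
      then show False using k by simp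
    qed
    then show "?c (index_of i) \<notin> span (?c ` {..<index_of i})"
      using row_notin_span[OF assms, of i "nth_index ` {..<index_of i}"]
      by (simp add: image_image)
  qed
  moreover have "orthogonal (gram_schmidt ?c (index_of i)) (gram_schmidt ?c (index_of j))"
    if "i \<noteq> j" for i j :: 'n
  proof -
    have "index_of i \<noteq> index_of j" using that by simp
    then show ?thesis unfolding orthogonal_def
      using gram_schmidt_orthogonal[of "index_of i" "index_of j" ?c]
        gram_schmidt_orthogonal[of "index_of j" "index_of i" ?c]
      by (metis inner_commute linorder_neqE_nat)
  qed
  ultimately show ?thesis
    by (simp add: orthogonal_matrix_orthonormal_rows orthonormalize_rows_def row_eq_nth)
qed

lemma rotation_matrix_rotation_of:
  fixes G :: "real^'n^'n"
  assumes "det G \<noteq> 0"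
  shows "rotation_matrix (rotation_of G)"
proof -
  let ?Q = "orthonormalize_rows G" and ?k = "nth_index 0"
  have Q: "orthogonal_matrix ?Q" by (rule orthogonal_matrix_orthonormalize_rows[OF assms])
  then have d: "det ?Q = 1 \<or> det ?Q = -1" by (rule det_orthogonal_matrix)
  have "rotation_of G = (\<chi> i. if i = ?k then det ?Q *s (?Q $ i) else ?Q $ i)"
    by (simp add: rotation_of_def vec_eq_iff scalar_mult_eq_scaleR)
  then have "det (rotation_of G) = det ?Q * det (\<chi> i. if i = ?k then ?Q $ i else ?Q $ i)"
    by (simp only: det_row_mul)
  then have "det (rotation_of G) = 1" using d by auto
  moreover have "orthogonal_matrix (rotation_of G)"
    using Q d unfolding orthogonal_matrix_orthonormal_rows row_eq_nth
    by (auto simp: rotation_of_def orthogonal_def)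
  ultimately show ?thesis by (simp add: rotation_matrix_def)
qed

lemma nth_matrix_mul: "(A ** B) $ i = (A $ i) v* B"
  by (simp add: matrix_matrix_mult_def vector_matrix_mult_def vec_eq_iff)

lemma rotation_matrix_transpose: "rotation_matrix A \<Longrightarrow> rotation_matrix (transpose A)"
  by (simp add: rotation_matrix_def orthogonal_matrix_transpose)

text \<open>Right multiplication by a rotation applies one isometry to all rows, and the Gram-Schmidt process
  uses only inner products and linear combinations of them.\<close>
lemma rotation_of_mul:
  fixes B G :: "real^'n^'n"
  assumes B: "rotation_matrix B"
  shows "rotation_of (G ** B) = rotation_of G ** B"
proof -
  have "rotation_matrix (transpose B)" using B by (rule rotation_matrix_transpose)
  then have "orthogonal_transformation ((*v) (transpose B))"
    by (simp add: orthogonal_transformation_matrix rotation_matrix_def)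
  then have f: "orthogonal_transformation (\<lambda>x. x v* B)"
    unfolding transpose_matrix_vector by simp
  have Q: "orthonormalize_rows (G ** B) = orthonormalize_rows G ** B"
    unfolding orthonormalize_rows_def vec_eq_iff[of _ "_ ** _"]
    by (simp add: nth_matrix_mul gram_schmidt_orthogonal_transformation[OF f])
  have "det (orthonormalize_rows (G ** B)) = det (orthonormalize_rows G)"
    using B by (simp add: Q det_mul rotation_matrix_def)
  then show ?thesis
    unfolding rotation_of_def vec_eq_iff[of _ "_ ** _"]
    by (simp add: Q nth_matrix_mul scaleR_vector_matrix_assoc)
qed

lemma measurable_rotation_of: "rotation_of \<in> borel_measurable borel"
proof -
  have [measurable]: "(\<lambda>G :: real^'n^'n. G $ i) \<in> borel_measurable borel" for i
    by (intro borel_measurable_continuous_onI continuous_intros)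
  have Q: "(\<lambda>G :: real^'n^'n. orthonormalize_rows G $ i) \<in> borel_measurable borel" for i
    unfolding orthonormalize_rows_def by (simp add: measurable_gram_schmidt)
  note [measurable] = this
  have [measurable]: "(\<lambda>G :: real^'n^'n. orthonormalize_rows G $ i $ j) \<in> borel_measurable borel" for i j
    by (rule measurable_compose[OF Q, of "\<lambda>x. x $ j"]) (intro borel_measurable_continuous_onI continuous_intros)
  have [measurable]: "(\<lambda>G :: real^'n^'n. det (orthonormalize_rows G)) \<in> borel_measurable borel"
    unfolding det_def by measurable
  show ?thesis
    unfolding rotation_of_def
    by (subst borel_measurable_euclidean_space) (auto simp: Basis_vec_def inner_axis)
qed

section \<open>An invariant distribution on the rotations\<close>

lemma det_nonzero_in_unit_ball:
  obtains G :: "real^'n^'n" where "G \<in> ball 0 1" "det G \<noteq> 0"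
proof -
  let ?c = "1 / (2 * norm (mat 1 :: real^'n^'n))"
  have n: "norm (mat 1 :: real^'n^'n) > 0"
    by (metis det_I det_0 zero_less_norm_iff zero_neq_one mat_0)
  show ?thesis
  proof (rule that[of "?c *\<^sub>R mat 1"])
    show "?c *\<^sub>R (mat 1 :: real^'n^'n) \<in> ball 0 1" using n by simp
    have "?c *\<^sub>R mat 1 = (mat ?c :: real^'n^'n)" by (simp add: mat_def vec_eq_iff)
    moreover have "det (mat ?c :: real^'n^'n) = (\<Prod>i\<in>(UNIV :: 'n set). ?c)"
      by (subst det_diagonal) (simp_all add: mat_def)
    ultimately show "det (?c *\<^sub>R (mat 1 :: real^'n^'n)) \<noteq> 0" using n by simp
  qed
qed

lemma orthogonal_transformation_matrix_mul_right:
  fixes B :: "real^'n^'n"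
  assumes "rotation_matrix B"
  shows "orthogonal_transformation (\<lambda>G :: real^'n^'n. G ** B)"
proof -
  have "rotation_matrix (transpose B)" using assms by (rule rotation_matrix_transpose)
  then have "(x v* B) \<bullet> (y v* B) = x \<bullet> y" for x y
    using rotation_inner[of "transpose B"] by simp
  moreover have "linear (\<lambda>G :: real^'n^'n. G ** B)"
    by (intro linearI) (simp_all add: vec_eq_iff[of "_ ** _"] nth_matrix_mul
        vector_matrix_left_distrib scaleR_vector_matrix_assoc)
  ultimately show ?thesis
    unfolding orthogonal_transformation_def inner_vec_def[of "_ ** _"] inner_vec_def[of "_ :: real^'n^'n"]
    by (simp add: nth_matrix_mul)
qed

text \<open>Take a uniformly distributed invertible matrix in the unit ball and orthonormalize it. Right
  multiplication by a rotation is an isometry of the space of matrices, so the uniform distribution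
  is invariant under it, and \<open>rotation_of_mul\<close> carries the invariance over to the rotations.\<close>
lemma ex_invariant_rotation_measure:
  obtains \<mu> :: "(real^'n^'n) measure"
  where "prob_space \<mu>" "sets \<mu> = sets borel" "AE A in \<mu>. rotation_matrix A"
    "\<And>B. rotation_matrix B \<Longrightarrow> distr \<mu> \<mu> (\<lambda>A. A ** B) = \<mu>"
proof -
  define U where "U = ball 0 1 \<inter> {G :: real^'n^'n. det G \<noteq> 0}"
  have "continuous_on UNIV (\<lambda>G :: real^'n^'n. det G)"
    unfolding det_def by (intro continuous_intros)
  then have "open {G :: real^'n^'n. det G \<noteq> 0}"
    by (intro open_Collect_neq continuous_on_const)
  then have U: "open U" unfolding U_def by auto
  have [measurable]: "U \<in> sets borel" using U by simp
  obtain G :: "real^'n^'n" where "G \<in> ball 0 1" "det G \<noteq> 0" by (rule det_nonzero_in_unit_ball)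
  then have "U \<noteq> {}" unfolding U_def by blast
  then have U0: "emeasure lborel U \<noteq> 0"
    using U open_not_negligible[of U] null_sets_completionI[of U lborel]
    by (auto simp: negligible_iff_null_sets null_sets_def)
  have "emeasure lborel U \<le> emeasure lborel (ball 0 1 :: (real^'n^'n) set)"
    by (intro emeasure_mono) (auto simp: U_def)
  then have U1: "emeasure lborel U \<noteq> \<infinity>"
    using emeasure_lborel_ball_finite[of "0 :: real^'n^'n" 1] by (simp add: top_unique less_top)
  let ?U = "uniform_measure lborel U"
  interpret U: prob_space ?U by (rule prob_space_uniform_measure[OF U0 U1])
  note measurable_rotation_of[measurable]
  define \<mu> where "\<mu> = distr ?U borel rotation_of"
  have meas: "rotation_of \<in> measurable ?U borel" by measurable
  have "prob_space \<mu>" unfolding \<mu>_def by (rule U.prob_space_distr[OF meas])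
  moreover have "sets \<mu> = sets borel" by (simp add: \<mu>_def)
  moreover have "AE A in \<mu>. rotation_matrix A"
  proof -
    have "AE A in ?U. rotation_matrix (rotation_of A)"
      by (intro AE_uniform_measureI AE_I2 impI) (simp, simp add: U_def rotation_matrix_rotation_of)
    moreover have "closed {A :: real^'n^'n. rotation_matrix A}"
    proof -
      have "continuous_on UNIV (\<lambda>A :: real^'n^'n. transpose A ** A)"
        unfolding matrix_matrix_mult_def transpose_def by (intro continuous_intros)
      moreover have "continuous_on UNIV (\<lambda>A :: real^'n^'n. det A)"
        unfolding det_def by (intro continuous_intros)
      ultimately have "closed ({A :: real^'n^'n. transpose A ** A = mat 1} \<inter> {A. det A = 1})"
        by (intro closed_Int closed_Collect_eq) auto
      then show ?thesis by (simp add: rotation_matrix_def orthogonal_matrix Collect_conj_eq)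
    qed
    ultimately show ?thesis unfolding \<mu>_def by (subst AE_distr_iff[OF meas]) simp_all
  qed
  moreover have "distr \<mu> \<mu> (\<lambda>A. A ** B) = \<mu>" if B: "rotation_matrix B" for B
  proof -
    have f: "orthogonal_transformation (\<lambda>G :: real^'n^'n. G ** B)"
      by (rule orthogonal_transformation_matrix_mul_right[OF B])
    have [measurable]: "(\<lambda>G :: real^'n^'n. G ** B) \<in> borel_measurable borel"
      using orthogonal_transformation_linear[OF f]
      by (intro borel_measurable_continuous_onI linear_continuous_on linear_conv_bounded_linear[THEN iffD1])
    have inv: "distr ?U borel (\<lambda>G. G ** B) = ?U"
    proof (rule measure_eqI)
      fix X assume "X \<in> sets (distr ?U borel (\<lambda>G. G ** B))"
      then have [measurable]: "X \<in> sets borel" by simp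
      have "U \<inter> (\<lambda>G. G ** B) -` X = (\<lambda>G. G ** B) -` (U \<inter> X)"
        using orthogonal_transformation_norm[OF f] B by (auto simp: U_def det_mul rotation_matrix_def)
      moreover have "emeasure lborel ((\<lambda>G. G ** B) -` (U \<inter> X)) = emeasure lborel (U \<inter> X)"
        by (subst (2) distr_lborel_orthogonal[OF f, symmetric]) (simp add: emeasure_distr)
      ultimately show "emeasure (distr ?U borel (\<lambda>G. G ** B)) X = emeasure ?U X"
        using measurable_sets_borel[of "\<lambda>G. G ** B" borel X] by (simp add: emeasure_distr)
    qed simp
    have "distr \<mu> borel (\<lambda>A. A ** B) = distr ?U borel ((\<lambda>A. A ** B) \<circ> rotation_of)"
      unfolding \<mu>_def by (rule distr_distr) simp_all
    also have "(\<lambda>A. A ** B) \<circ> rotation_of = rotation_of \<circ> (\<lambda>G. G ** B)"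
      by (simp add: fun_eq_iff rotation_of_mul[OF B])
    also have "distr ?U borel (rotation_of \<circ> (\<lambda>G. G ** B)) = distr (distr ?U borel (\<lambda>G. G ** B)) borel rotation_of"
      by (rule distr_distr[symmetric]) simp_all
    also have "\<dots> = \<mu>" unfolding inv by (simp add: \<mu>_def)
    finally show ?thesis by (simp add: \<mu>_def cong: distr_cong)
  qed
  ultimately show ?thesis using that by blast
qed

lemma ex_rotation:
  fixes u v :: "real^'n"
  assumes "2 \<le> CARD('n)" "norm u = norm v"
  obtains A where "rotation_matrix A" "A *v u = v"
proof -
  obtain f :: "real^'n \<Rightarrow> real^'n" where f: "orthogonal_transformation f" "det (matrix f) = 1" "f u = v"
    using rotation_exists[OF assms] .
  then have "rotation_matrix (matrix f)"
    by (simp add: rotation_matrix_def orthogonal_transformation_matrix)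
  moreover have "matrix f *v u = v"
    using f by (simp add: matrix_works orthogonal_transformation_linear)
  ultimately show ?thesis by (rule that)
qed

lemma norm_rotation: "rotation_matrix (A :: real^'n^'n) \<Longrightarrow> norm (A *v x) = norm x"
  using rotation_inner[of A x x] by (simp add: norm_eq_sqrt_inner)

lemma haar_sphere_sets:
  assumes "haar_sphere \<sigma>"
  shows "X \<in> sets \<sigma> \<longleftrightarrow> X \<in> sets borel \<and> X \<subseteq> sphere 0 1"
  using assms by (auto simp: haar_sphere_def sets_restrict_space_iff)

lemma haar_sphere_space:
  assumes "haar_sphere \<sigma>"
  shows "space \<sigma> = sphere 0 1"
proof -
  have "sets \<sigma> = sets (restrict_space borel (sphere 0 1))" using assms by (simp add: haar_sphere_def)
  from sets_eq_imp_space_eq[OF this] show ?thesis by (simp add: space_restrict_space)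
qed

lemma measurable_rotation_sphere:
  assumes \<sigma>: "haar_sphere \<sigma>" and A: "rotation_matrix A"
  shows "(*v) A \<in> measurable \<sigma> \<sigma>"
proof -
  have sets: "sets \<sigma> = sets (restrict_space borel (sphere 0 1))"
    using \<sigma> by (simp add: haar_sphere_def)
  have "(*v) A \<in> measurable (restrict_space borel (sphere 0 1)) (restrict_space borel (sphere 0 1))"
    by (intro measurable_restrict_space3)
      (auto simp: norm_rotation[OF A] intro!: borel_measurable_continuous_onI linear_continuous_on
        matrix_vector_mul_bounded_linear)
  then show ?thesis by (simp add: measurable_cong_sets[OF sets sets])
qed

lemma emeasure_rotation_vimage:
  assumes \<sigma>: "haar_sphere \<sigma>" and A: "rotation_matrix A" and X: "X \<in> sets \<sigma>"
  shows "emeasure \<sigma> ((*v) A -` X \<inter> sphere 0 1) = emeasure \<sigma> X"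
proof -
  have "distr \<sigma> \<sigma> ((*v) A) = \<sigma>" using \<sigma> A by (simp add: haar_sphere_def)
  then show ?thesis
    using emeasure_distr[OF measurable_rotation_sphere[OF \<sigma> A] X] haar_sphere_space[OF \<sigma>] by simp
qed

text \<open>A random rotation takes every fixed point \<open>v\<close> to a \<open>\<sigma>\<close>-distributed point. By right invariance and
  transitivity, the probability that \<open>A *v x \<in> L\<close> is the same for all \<open>x\<close>; averaged over \<open>x\<close>, it is
  \<open>\<sigma> L\<close> by Fubini, because every rotation preserves \<open>\<sigma>\<close>.\<close>
lemma measure_rotations_into:
  fixes \<sigma> :: "(real^'n) measure" and \<mu> :: "(real^'n^'n) measure"
  assumes n: "2 \<le> CARD('n)" and \<sigma>: "haar_sphere \<sigma>"
    and \<mu>: "prob_space \<mu>" "sets \<mu> = sets borel" "AE A in \<mu>. rotation_matrix A"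
    "\<And>B. rotation_matrix B \<Longrightarrow> distr \<mu> \<mu> (\<lambda>A. A ** B) = \<mu>"
    and L: "L \<in> sets \<sigma>" and v: "norm v = 1"
  shows "{A. A *v v \<in> L} \<in> sets \<mu>" and "emeasure \<mu> {A. A *v v \<in> L} = emeasure \<sigma> L"
proof -
  interpret \<mu>: prob_space \<mu> by fact
  interpret \<sigma>: prob_space \<sigma> using \<sigma> by (simp add: haar_sphere_def)
  interpret pair_prob_space \<mu> \<sigma> ..
  have sp\<mu>: "space \<mu> = UNIV" using sets_eq_imp_space_eq[OF \<mu>(2)] by simp
  note sp\<sigma> = haar_sphere_space[OF \<sigma>]
  have Lb[measurable]: "L \<in> sets borel" using L haar_sphere_sets[OF \<sigma>] by simp
  have hm: "{A. A *v x \<in> L} \<in> sets \<mu>" for x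
  proof -
    have "(\<lambda>A. A *v x) \<in> borel_measurable borel"
      unfolding matrix_vector_mult_def
      by (intro borel_measurable_continuous_onI continuous_intros)
    from measurable_sets[OF this Lb] show ?thesis by (simp add: \<mu>(2) vimage_def)
  qed
  then show "{A. A *v v \<in> L} \<in> sets \<mu>" .
  have const: "emeasure \<mu> {A. A *v x \<in> L} = emeasure \<mu> {A. A *v v \<in> L}" if x: "norm x = 1" for x
  proof -
    obtain B where B: "rotation_matrix B" "B *v x = v" using ex_rotation[OF n, of x v] v x by auto
    have "(\<lambda>A. A ** B) \<in> borel_measurable borel"
      unfolding matrix_matrix_mult_def by (intro borel_measurable_continuous_onI continuous_intros)
    then have m: "(\<lambda>A. A ** B) \<in> measurable \<mu> \<mu>" by (simp add: measurable_cong_sets[OF \<mu>(2) \<mu>(2)])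
    have "emeasure \<mu> {A. A *v x \<in> L} = emeasure \<mu> ((\<lambda>A. A ** B) -` {A. A *v x \<in> L} \<inter> space \<mu>)"
      using emeasure_distr[OF m hm[of x]] by (simp add: \<mu>(4)[OF B(1)])
    also have "(\<lambda>A. A ** B) -` {A. A *v x \<in> L} \<inter> space \<mu> = {A. A *v v \<in> L}"
      using B(2) by (auto simp: sp\<mu> simp flip: matrix_vector_mul_assoc)
    finally show ?thesis .
  qed
  have "(\<lambda>p. fst p *v snd p) \<in> borel_measurable (borel :: ((real^'n^'n) \<times> (real^'n)) measure)"
    unfolding matrix_vector_mult_def by (intro borel_measurable_continuous_onI continuous_intros)
  then have m: "(\<lambda>p. fst p *v snd p) \<in> borel_measurable (borel \<Otimes>\<^sub>M borel :: ((real^'n^'n) \<times> (real^'n)) measure)"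
    by (simp add: borel_prod)
  have "(\<lambda>x. x) \<in> measurable (restrict_space borel (sphere 0 1)) borel"
    by (intro measurable_restrict_space1) simp
  moreover have s: "sets \<sigma> = sets (restrict_space borel (sphere 0 1))" using \<sigma> by (simp add: haar_sphere_def)
  ultimately have [measurable]: "(\<lambda>x. x) \<in> measurable \<sigma> borel" by (simp add: measurable_cong_sets[OF s])
  have [measurable]: "(\<lambda>x. x) \<in> measurable \<mu> borel" by (simp add: measurable_cong_sets[OF \<mu>(2)])
  have "(\<lambda>p. (fst p, snd p)) \<in> measurable (\<mu> \<Otimes>\<^sub>M \<sigma>) (borel \<Otimes>\<^sub>M borel)"
    by (intro measurable_Pair measurable_compose[OF measurable_fst] measurable_compose[OF measurable_snd]) simp_all
  from measurable_compose[OF this m]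
  have [measurable]: "(\<lambda>p. fst p *v snd p) \<in> borel_measurable (\<mu> \<Otimes>\<^sub>M \<sigma>)" by simp
  let ?f = "\<lambda>p. indicator L (fst p *v snd p) :: ennreal"
  have f: "?f \<in> borel_measurable (\<mu> \<Otimes>\<^sub>M \<sigma>)" by measurable
  have "emeasure \<mu> {A. A *v v \<in> L} = (\<integral>\<^sup>+ x. emeasure \<mu> {A. A *v v \<in> L} \<partial>\<sigma>)"
    by (simp add: \<sigma>.emeasure_space_1)
  also have "\<dots> = (\<integral>\<^sup>+ x. (\<integral>\<^sup>+ A. ?f (A, x) \<partial>\<mu>) \<partial>\<sigma>)"
  proof (rule nn_integral_cong)
    fix x assume "x \<in> space \<sigma>"
    then have x: "norm x = 1" by (simp add: sp\<sigma>)
    have "(\<integral>\<^sup>+ A. ?f (A, x) \<partial>\<mu>) = (\<integral>\<^sup>+ A. indicator {A. A *v x \<in> L} A \<partial>\<mu>)"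
      by (simp add: indicator_def)
    then show "emeasure \<mu> {A. A *v v \<in> L} = (\<integral>\<^sup>+ A. ?f (A, x) \<partial>\<mu>)"
      using hm[of x] const[OF x] by simp
  qed
  also have "\<dots> = (\<integral>\<^sup>+ A. (\<integral>\<^sup>+ x. ?f (A, x) \<partial>\<sigma>) \<partial>\<mu>)"
    by (rule Fubini[OF f])
  also have "\<dots> = (\<integral>\<^sup>+ A. emeasure \<sigma> L \<partial>\<mu>)"
  proof (rule nn_integral_cong_AE, use \<mu>(3) in eventually_elim)
    case (elim A)
    have X: "(*v) A -` L \<inter> sphere 0 1 \<in> sets \<sigma>"
      using measurable_sets[OF measurable_rotation_sphere[OF \<sigma> elim] L] by (simp add: sp\<sigma>)
    have "(\<integral>\<^sup>+ x. ?f (A, x) \<partial>\<sigma>) = (\<integral>\<^sup>+ x. indicator ((*v) A -` L \<inter> sphere 0 1) x \<partial>\<sigma>)"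
      by (rule nn_integral_cong) (simp add: indicator_def sp\<sigma>)
    then show ?case using X emeasure_rotation_vimage[OF \<sigma> elim L] by simp
  qed
  also have "\<dots> = emeasure \<sigma> L" by (simp add: \<mu>.emeasure_space_1)
  finally show "emeasure \<mu> {A. A *v v \<in> L} = emeasure \<sigma> L" .
qed

section \<open>The measure of balls in the sphere\<close>

lemma haar_sphere_ball_in_sets:
  assumes "haar_sphere \<sigma>"
  shows "sphere 0 1 \<inter> ball u r \<in> sets \<sigma>" "sphere 0 1 \<inter> cball u r \<in> sets \<sigma>"
  using haar_sphere_sets[OF assms] by auto

lemma measure_sphere_ball_eq:
  fixes \<sigma> :: "(real^'n) measure"
  assumes n: "2 \<le> CARD('n)" and \<sigma>: "haar_sphere \<sigma>" and u: "norm u = 1" "norm w = 1"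
  shows "measure \<sigma> (sphere 0 1 \<inter> ball u r) = measure \<sigma> (sphere 0 1 \<inter> ball w r)"
proof -
  obtain A where A: "rotation_matrix A" "A *v u = w" using ex_rotation[OF n, of u w] u by auto
  have "dist w (A *v x) = dist u x" for x
    using norm_rotation[OF A(1), of "u - x"] A(2) by (simp add: dist_norm matrix_vector_mult_diff_distrib)
  then have "(*v) A -` (sphere 0 1 \<inter> ball w r) \<inter> sphere 0 1 = sphere 0 1 \<inter> ball u r"
    by (auto simp: norm_rotation[OF A(1)])
  then show ?thesis
    using emeasure_rotation_vimage[OF \<sigma> A(1) haar_sphere_ball_in_sets(1)[OF \<sigma>], of w r]
    by (simp add: measure_def)
qed

text \<open>The unit ball of the ambient space is covered by finitely many balls of radius \<open>k / 2\<close>, and by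
  scaling the same number serves at every radius \<open>r\<close>. A small ball that meets the sphere in \<open>z\<close> lies
  in the ball of radius \<open>k * r\<close> around \<open>z\<close>, whose measure does not depend on \<open>z\<close>.\<close>
lemma haar_sphere_doubling:
  fixes \<sigma> :: "(real^'n) measure"
  assumes n: "2 \<le> CARD('n)" and \<sigma>: "haar_sphere \<sigma>" and k: "0 < k"
  obtains C where "\<And>r u w. 0 < r \<Longrightarrow> norm w = 1 \<Longrightarrow>
    measure \<sigma> (sphere 0 1 \<inter> cball u r) \<le> C * measure \<sigma> (sphere 0 1 \<inter> ball w (k * r))"
proof -
  interpret prob_space \<sigma> using \<sigma> by (simp add: haar_sphere_def)
  have cov: "cball 0 1 \<subseteq> (\<Union>p\<in>UNIV. ball p (k / 2) :: (real^'n) set)"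
    using k by (meson UN_I UNIV_I centre_in_ball half_gt_zero subsetI)
  obtain P :: "(real^'n) set" where P: "finite P" "cball 0 1 \<subseteq> (\<Union>p\<in>P. ball p (k / 2))"
    by (rule compactE_image[OF compact_cball _ cov]) auto
  show ?thesis
  proof (rule that[of "real (card P)"])
    fix r :: real and u w :: "real^'n" assume r: "0 < r" and w: "norm w = 1"
    let ?D = "\<lambda>p. sphere 0 1 \<inter> ball (u + r *\<^sub>R p) (k / 2 * r)"
    have le: "measure \<sigma> (?D p) \<le> measure \<sigma> (sphere 0 1 \<inter> ball w (k * r))" for p
    proof (cases "?D p = {}")
      case False
      then obtain z where z: "norm z = 1" "dist (u + r *\<^sub>R p) z < k / 2 * r" by auto
      have "?D p \<subseteq> sphere 0 1 \<inter> ball z (k * r)"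
      proof
        fix x assume x: "x \<in> ?D p"
        then have "dist z x < k / 2 * r + k / 2 * r"
          using z(2) dist_triangle[of z x "u + r *\<^sub>R p"] by (simp add: dist_commute)
        then show "x \<in> sphere 0 1 \<inter> ball z (k * r)" using x by simp
      qed
      then have "measure \<sigma> (?D p) \<le> measure \<sigma> (sphere 0 1 \<inter> ball z (k * r))"
        by (intro finite_measure_mono haar_sphere_ball_in_sets[OF \<sigma>])
      then show ?thesis using measure_sphere_ball_eq[OF n \<sigma> z(1) w] by simp
    qed simp
    have "sphere 0 1 \<inter> cball u r \<subseteq> (\<Union>p\<in>P. ?D p)"
    proof
      fix x assume x: "x \<in> sphere 0 1 \<inter> cball u r"
      then have "(1 / r) *\<^sub>R (x - u) \<in> cball 0 1"
        using r by (simp add: dist_norm norm_minus_commute)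
      then obtain p where p: "p \<in> P" "dist p ((1 / r) *\<^sub>R (x - u)) < k / 2" using P(2) by (meson UN_E mem_ball subsetD)
      have "dist (u + r *\<^sub>R p) x = norm (r *\<^sub>R (p - (1 / r) *\<^sub>R (x - u)))"
        using r by (simp add: dist_norm algebra_simps)
      also have "\<dots> < r * (k / 2)"
        using r p(2) by (simp add: dist_norm)
      finally show "x \<in> (\<Union>p\<in>P. ?D p)" using p(1) x by (auto simp: mult.commute)
    qed
    then have "measure \<sigma> (sphere 0 1 \<inter> cball u r) \<le> measure \<sigma> (\<Union>p\<in>P. ?D p)"
      by (intro finite_measure_mono sets.finite_UN[OF P(1)] haar_sphere_ball_in_sets[OF \<sigma>])
    also have "\<dots> \<le> (\<Sum>p\<in>P. measure \<sigma> (?D p))"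
      using haar_sphere_ball_in_sets(1)[OF \<sigma>] by (intro finite_measure_subadditive_finite[OF P(1)]) auto
    also have "\<dots> \<le> card P * measure \<sigma> (sphere 0 1 \<inter> ball w (k * r))"
      by (rule sum_bounded_above) (rule le)
    finally show "measure \<sigma> (sphere 0 1 \<inter> cball u r) \<le> card P * measure \<sigma> (sphere 0 1 \<inter> ball w (k * r))" .
  qed
qed

text \<open>The doubling inequality bounds the measure 1 of the whole sphere by a multiple of this one.\<close>
lemma measure_sphere_ball_pos:
  fixes \<sigma> :: "(real^'n) measure"
  assumes n: "2 \<le> CARD('n)" and \<sigma>: "haar_sphere \<sigma>" and w: "norm w = 1" and r: "0 < r"
  shows "0 < measure \<sigma> (sphere 0 1 \<inter> ball w r)"
proof -
  interpret prob_space \<sigma> using \<sigma> by (simp add: haar_sphere_def)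
  obtain C where C: "\<And>r' u w. 0 < r' \<Longrightarrow> norm w = 1 \<Longrightarrow>
    measure \<sigma> (sphere 0 1 \<inter> cball u r') \<le> C * measure \<sigma> (sphere 0 1 \<inter> ball w (r * r'))"
    using haar_sphere_doubling[OF n \<sigma> r] by blast
  have "sphere 0 1 \<inter> cball 0 1 = space \<sigma>" by (auto simp: haar_sphere_space[OF \<sigma>])
  then have "1 \<le> C * measure \<sigma> (sphere 0 1 \<inter> ball w r)"
    using C[of 1 w 0] w prob_space by simp
  then show ?thesis by (smt (verit) measure_nonneg mult_eq_0_iff)
qed

section \<open>Measurability of inner parallel bodies\<close>

text \<open>Porous sets are null. At scale \<open>r\<close>, pick a maximal family of disjoint balls of radius \<open>r\<close> centred
  in \<open>Y\<close>. The balls of radius \<open>2 * r\<close> cover the closure \<open>Z\<close> of \<open>Y\<close>, and each of the disjoint balls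
  contains a hole of radius \<open>k * r\<close> outside \<open>Z\<close>. By doubling, the measure of \<open>Z\<close> is at most \<open>C\<close> times that of
  the holes, hence of what the \<open>r\<close>-neighbourhood of \<open>Z\<close> adds to \<open>Z\<close>; this tends to 0
  with \<open>r\<close>, as \<open>Z\<close> is closed. Passing to the closure makes the argument apply to non-measurable \<open>Y\<close>.\<close>
lemma porous_null:
  fixes \<sigma> :: "(real^'n) measure"
  assumes n: "2 \<le> CARD('n)" and \<sigma>: "haar_sphere \<sigma>" and Y: "Y \<subseteq> sphere 0 1"
    and k: "0 < k" "k \<le> 1 / 2" and R: "0 < R"
    and por: "\<And>r x. 0 < r \<Longrightarrow> r < R \<Longrightarrow> x \<in> Y \<Longrightarrow>
      \<exists>y\<in>sphere 0 1. dist x y \<le> r / 2 \<and> ball y (k * r) \<inter> Y = {}"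
  shows "Y \<in> null_sets (completion \<sigma>)"
proof (cases "Y = {}")
  case False
  interpret prob_space \<sigma> using \<sigma> by (simp add: haar_sphere_def)
  define Z where "Z = closure Y"
  have ZS: "Z \<subseteq> sphere 0 1" unfolding Z_def by (rule closure_minimal[OF Y]) simp
  have Z[measurable]: "Z \<in> sets \<sigma>" using ZS by (simp add: haar_sphere_sets[OF \<sigma>] Z_def)
  define T where "T r = sphere 0 1 \<inter> {x. infdist x Z \<le> r}" for r
  have T[measurable]: "T r \<in> sets \<sigma>" for r
  proof -
    have "closed {x. infdist x Z \<le> r}" by (intro closed_Collect_le continuous_intros)
    then show ?thesis by (simp add: haar_sphere_sets[OF \<sigma>] T_def)
  qed
  have ZT: "Z \<subseteq> T r" if "0 \<le> r" for r using ZS that by (auto simp: T_def)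
  obtain C where C: "\<And>r u w. 0 < r \<Longrightarrow> norm w = 1 \<Longrightarrow>
      measure \<sigma> (sphere 0 1 \<inter> cball u r) \<le> C * measure \<sigma> (sphere 0 1 \<inter> ball w (k / 2 * r))"
    using haar_sphere_doubling[OF n \<sigma>, of "k / 2"] k by auto
  have C0: "0 \<le> C"
  proof (rule ccontr)
    assume "\<not> 0 \<le> C"
    obtain x where "x \<in> Y" using False by blast
    then have x: "norm x = 1" using Y by auto
    have "0 < measure \<sigma> (sphere 0 1 \<inter> ball x (k / 2 * 1))"
      using measure_sphere_ball_pos[OF n \<sigma> x] k by simp
    then have "C * measure \<sigma> (sphere 0 1 \<inter> ball x (k / 2 * 1)) < 0"
      using \<open>\<not> 0 \<le> C\<close> by (simp add: mult_less_0_iff)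
    then show False using C[of 1 x x] x measure_nonneg[of \<sigma> "sphere 0 1 \<inter> cball x 1"] by linarith
  qed
  have step: "prob Z \<le> C * (prob (T r) - prob Z)" if r: "0 < r" "r < R" for r
  proof -
    let ?B = "\<lambda>x. sphere 0 1 \<inter> cball x r"
    obtain w where "w \<in> Y" using False by blast
    then have w: "norm w = 1" using Y by auto
    have pos: "0 < prob (sphere 0 1 \<inter> ball w r)" by (rule measure_sphere_ball_pos[OF n \<sigma> w r(1)])
    have "prob (sphere 0 1 \<inter> ball w r) \<le> prob (?B x)" if "x \<in> Y" for x
    proof -
      have "norm x = 1" using that Y by auto
      from measure_sphere_ball_eq[OF n \<sigma> w this, of r] show ?thesis
        using finite_measure_mono[of "sphere 0 1 \<inter> ball x r" "?B x"] haar_sphere_ball_in_sets[OF \<sigma>] by force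
    qed
    then obtain V where V: "V \<subseteq> Y" "finite V" "disjoint_family_on ?B V"
        "\<And>x. x \<in> Y \<Longrightarrow> \<exists>v\<in>V. ?B x \<inter> ?B v \<noteq> {}"
      using finite_maximal_disjoint[of "prob (sphere 0 1 \<inter> ball w r)" Y ?B, OF pos haar_sphere_ball_in_sets(2)[OF \<sigma>]] by blast
    have "\<forall>v\<in>V. \<exists>y\<in>sphere 0 1. dist v y \<le> r / 2 \<and> ball y (k * r) \<inter> Y = {}"
      using por[OF r] V(1) by blast
    then obtain y where y: "\<And>v. v \<in> V \<Longrightarrow> norm (y v) = 1" "\<And>v. v \<in> V \<Longrightarrow> dist v (y v) \<le> r / 2"
        "\<And>v. v \<in> V \<Longrightarrow> ball (y v) (k * r) \<inter> Y = {}"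
      by (metis bchoice mem_sphere_0)
    let ?H = "\<lambda>v. sphere 0 1 \<inter> ball (y v) (k * r)"
    have HB: "?H v \<subseteq> ?B v" if "v \<in> V" for v
    proof
      fix x assume x: "x \<in> ?H v"
      then have "dist v x \<le> r / 2 + k * r"
        using y(2)[OF that] dist_triangle[of v x "y v"] by simp
      also have "\<dots> \<le> r / 2 + 1 / 2 * r" using k r by (intro add_left_mono mult_right_mono) auto
      finally show "x \<in> ?B v" using x by simp
    qed
    have HZ: "?H v \<inter> Z = {}" if "v \<in> V" for v
      using y(3)[OF that] open_Int_closure_eq_empty[of "ball (y v) (k * r)" Y] by (auto simp: Z_def)
    have HT: "?H v \<subseteq> T r - Z" if v: "v \<in> V" for v
    proof
      fix x assume x: "x \<in> ?H v"
      have "v \<in> Z" using v V(1) closure_subset by (auto simp: Z_def)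
      then have "infdist x Z \<le> dist x v" by (rule infdist_le)
      also have "\<dots> \<le> r" using HB[OF v] x by (auto simp: dist_commute)
      finally show "x \<in> T r - Z" using x HZ[OF v] by (auto simp: T_def)
    qed
    have "Y \<subseteq> (\<Union>v\<in>V. cball v (2 * r))"
    proof
      fix x assume "x \<in> Y"
      then obtain v z where "v \<in> V" "dist x z \<le> r" "dist v z \<le> r" using V(4) by fastforce
      then have "v \<in> V" "x \<in> cball v (2 * r)"
        using dist_triangle[of v x z] by (auto simp: dist_commute)
      then show "x \<in> (\<Union>v\<in>V. cball v (2 * r))" by blast
    qed
    then have "Z \<subseteq> (\<Union>v\<in>V. cball v (2 * r))"
      unfolding Z_def using V(2) by (intro closure_minimal closed_UN) auto
    then have "Z \<subseteq> (\<Union>v\<in>V. sphere 0 1 \<inter> cball v (2 * r))" using ZS by auto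
    then have "prob Z \<le> prob (\<Union>v\<in>V. sphere 0 1 \<inter> cball v (2 * r))"
      by (intro finite_measure_mono sets.finite_UN[OF V(2)] haar_sphere_ball_in_sets[OF \<sigma>])
    also have "\<dots> \<le> (\<Sum>v\<in>V. prob (sphere 0 1 \<inter> cball v (2 * r)))"
      using haar_sphere_ball_in_sets(2)[OF \<sigma>] by (intro finite_measure_subadditive_finite[OF V(2)]) auto
    also have "\<dots> \<le> (\<Sum>v\<in>V. C * prob (?H v))"
      using C[of "2 * r"] y(1) r by (intro sum_mono) auto
    also have "\<dots> = C * (\<Sum>v\<in>V. prob (?H v))" by (simp add: sum_distrib_left)
    also have "(\<Sum>v\<in>V. prob (?H v)) = prob (\<Union>v\<in>V. ?H v)"
    proof (rule finite_measure_finite_Union[symmetric, OF V(2)])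
      show "?H ` V \<subseteq> events" using haar_sphere_ball_in_sets(1)[OF \<sigma>] by auto
      show "disjoint_family_on ?H V"
        unfolding disjoint_family_on_def
      proof (intro ballI impI)
        fix a b assume ab: "a \<in> V" "b \<in> V" "a \<noteq> b"
        then have "?B a \<inter> ?B b = {}" using V(3) by (simp add: disjoint_family_on_def)
        then show "?H a \<inter> ?H b = {}" using HB[OF ab(1)] HB[OF ab(2)] by blast
      qed
    qed
    also have "C * prob (\<Union>v\<in>V. ?H v) \<le> C * prob (T r - Z)"
      using C0 HT by (intro mult_left_mono finite_measure_mono) auto
    also have "prob (T r - Z) = prob (T r) - prob Z"
      using ZT r by (intro finite_measure_Diff) auto
    finally show ?thesis .
  qed
  define s where "s i = R / (real i + 2)" for i :: nat
  have s: "0 < s i" "s i < R" for i using R by (auto simp: s_def field_simps intro: add_pos_nonneg)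
  have s0: "s \<longlonglongrightarrow> 0" unfolding s_def by real_asymp
  have "(\<lambda>i. prob (T (s i))) \<longlonglongrightarrow> prob (\<Inter>i. T (s i))"
  proof (rule finite_Lim_measure_decseq)
    show "decseq (\<lambda>i. T (s i))"
    proof (intro decseq_SucI subsetI)
      fix i x assume "x \<in> T (s (Suc i))"
      moreover have "s (Suc i) \<le> s i" using R by (simp add: s_def frac_le)
      ultimately show "x \<in> T (s i)" by (auto simp: T_def)
    qed
  qed auto
  moreover have "(\<Inter>i. T (s i)) = Z"
  proof
    show "Z \<subseteq> (\<Inter>i. T (s i))" using ZT s by (auto intro: less_imp_le)
    show "(\<Inter>i. T (s i)) \<subseteq> Z"
    proof
      fix x assume x: "x \<in> (\<Inter>i. T (s i))"
      then have "infdist x Z \<le> 0" using s0 by (intro LIMSEQ_le_const) (auto simp: T_def)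
      then have "infdist x Z = 0" using infdist_nonneg[of x Z] by linarith
      then show "x \<in> Z" using False by (subst in_closed_iff_infdist_zero) (auto simp: Z_def)
    qed
  qed
  ultimately have "(\<lambda>i. C * (prob (T (s i)) - prob Z)) \<longlonglongrightarrow> C * (prob Z - prob Z)"
    by (intro tendsto_intros) simp
  then have "prob Z \<le> C * (prob Z - prob Z)"
    using step[OF s] by (intro LIMSEQ_le_const) auto
  then have "prob Z = 0" using measure_nonneg[of \<sigma> Z] by simp
  then have "Z \<in> null_sets (completion \<sigma>)"
    by (intro null_sets_completionI) (simp add: null_sets_def emeasure_eq_measure)
  moreover have "Y \<subseteq> Z" by (simp add: Z_def closure_subset)
  ultimately show ?thesis by (meson null_sets_completion_subset)
qed simp

text \<open>The inner parallel body is \<open>K\<close> minus the union of all closed caps of radius \<open>\<phi>\<close> with centre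
  outside \<open>K\<close>. The corresponding open caps have an open union \<open>E\<close>. A point \<open>x\<close> of the remaining part
  \<open>Y\<close> has angle exactly \<open>\<phi>\<close> to some centre \<open>v\<close>, and the points slightly further along the arc to \<open>v\<close>
  have neighbourhoods in \<open>E\<close>, of radius proportional to the step. So \<open>Y\<close> is porous.\<close>
lemma inner_parallel_in_sets:
  fixes \<sigma> :: "(real^'n) measure"
  assumes n: "2 \<le> CARD('n)" and \<sigma>: "haar_sphere \<sigma>" and K: "K \<in> sets (completion \<sigma>)" and \<phi>: "0 < \<phi>"
  shows "inner_parallel K \<phi> \<in> sets (completion \<sigma>)"
proof -
  have KS: "K \<subseteq> sphere 0 1"
    using sets.sets_into_space[OF K] haar_sphere_space[OF \<sigma>] by simp
  have bd: "\<bar>x \<bullet> v\<bar> \<le> 1" if "norm x = 1" "norm v = 1" for x v :: "real^'n"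
    using Cauchy_Schwarz_ineq2[of x v] that by simp
  show ?thesis
  proof (cases "\<phi> < pi")
    case False
    \<comment> \<open>A cap of radius at least \<open>pi\<close> is the whole sphere.\<close>
    have "cap u \<phi> = sphere 0 1" if "u \<in> K" for u
    proof -
      have "arccos (u \<bullet> v) \<le> \<phi>" if "norm v = 1" for v
        using bd[of u v] that \<open>u \<in> K\<close> KS arccos_ubound[of "u \<bullet> v"] False by (force simp: abs_le_iff)
      then show ?thesis by (auto simp: cap_def)
    qed
    then have "inner_parallel K \<phi> = {} \<or> inner_parallel K \<phi> = K"
      using KS by (auto simp: inner_parallel_def)
    then show ?thesis using K by auto
  next
    case True
    define E where "E = sphere 0 1 \<inter> (\<Union>v\<in>sphere 0 1 - K. {x. cos \<phi> < x \<bullet> v})"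
    have E_iff: "x \<in> E \<longleftrightarrow> (\<exists>v\<in>sphere 0 1 - K. arccos (x \<bullet> v) < \<phi>)" if x: "x \<in> sphere 0 1" for x
    proof -
      have "cos \<phi> < x \<bullet> v \<longleftrightarrow> arccos (x \<bullet> v) < \<phi>" if "v \<in> sphere 0 1" for v
        using arccos_less_mono[of "x \<bullet> v" "cos \<phi>"] bd[of x v] x that \<phi> True by (simp add: arccos_cos)
      then show ?thesis using x by (auto simp: E_def)
    qed
    have "open (\<Union>v\<in>sphere 0 1 - K. {x. cos \<phi> < x \<bullet> v})"
      by (intro open_UN ballI open_Collect_less continuous_intros)
    then have E: "E \<in> sets \<sigma>" by (simp add: haar_sphere_sets[OF \<sigma>] E_def)
    define Y where "Y = {x \<in> sphere 0 1. \<exists>v\<in>sphere 0 1 - K. arccos (x \<bullet> v) \<le> \<phi>} - E"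
    have "Y \<in> null_sets (completion \<sigma>)"
    \<comment> \<open>A step of length \<open>r / 2\<close> towards \<open>v\<close> gains the angle \<open>r / 2\<close>; a ball of chordal radius \<open>r / 4\<close>
      loses less than that, as angles are at most twice the chords.\<close>
    proof (rule porous_null[OF n \<sigma>, where k = "1/4" and R = \<phi>])
      show "Y \<subseteq> sphere 0 1" by (auto simp: Y_def)
      fix r x assume r: "0 < r" "r < \<phi>" and x: "x \<in> Y"
      obtain v where v: "norm v = 1" "v \<notin> K" "arccos (x \<bullet> v) \<le> \<phi>" using x by (auto simp: Y_def)
      have nx: "norm x = 1" "x \<notin> E" using x by (auto simp: Y_def)
      have a: "arccos (x \<bullet> v) = \<phi>" using v nx E_iff[of x] by force
      obtain y where y: "norm y = 1" "dist x y \<le> r / 2" "arccos (y \<bullet> v) = \<phi> - r / 2"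
        using geodesic_point[OF nx(1) v(1), of "r / 2"] a r \<phi> True by force
      have "z \<notin> Y" if z: "z \<in> ball y (1 / 4 * r)" for z
      proof
        assume "z \<in> Y"
        then have nz: "norm z = 1" "z \<notin> E" by (auto simp: Y_def)
        have "arccos (z \<bullet> v) \<le> arccos (z \<bullet> y) + arccos (y \<bullet> v)"
          by (rule arccos_inner_triangle[OF nz(1) y(1) v(1)])
        also have "\<dots> \<le> 2 * dist z y + (\<phi> - r / 2)"
          using arccos_inner_le_dist[OF nz(1) y(1)] y(3) by simp
        also have "\<dots> < \<phi>" using z by (simp add: dist_commute)
        finally show False using nz v E_iff[of z] by auto
      qed
      then show "\<exists>y\<in>sphere 0 1. dist x y \<le> r / 2 \<and> ball y (1 / 4 * r) \<inter> Y = {}"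
        using y by (intro bexI[of _ y]) auto
    qed (use \<phi> in auto)
    moreover have "inner_parallel K \<phi> = K - E - Y"
    proof -
      have "cap u \<phi> \<subseteq> K \<longleftrightarrow> u \<notin> E \<union> Y" if "u \<in> K" for u
        using that KS E_iff[of u] by (force simp: Y_def cap_def)
      then show ?thesis by (auto simp: inner_parallel_def)
    qed
    ultimately show ?thesis using K E by auto
  qed
qed

section \<open>Covering the sphere by rotated copies\<close>

lemma cap_measure_pos:
  fixes \<sigma> :: "(real^'n) measure"
  assumes n: "2 \<le> CARD('n)" and \<sigma>: "haar_sphere \<sigma>" and \<phi>: "0 < \<phi>"
  shows "0 < cap_measure \<sigma> \<phi>"
proof -
  interpret prob_space \<sigma> using \<sigma> by (simp add: haar_sphere_def)
  obtain u :: "real^'n" where u: "norm u = 1" using vector_choose_size[of 1] by auto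
  have "sphere 0 1 \<inter> ball u (\<phi> / 2) \<subseteq> cap u \<phi>"
  proof
    fix x assume x: "x \<in> sphere 0 1 \<inter> ball u (\<phi> / 2)"
    then have "arccos (u \<bullet> x) \<le> 2 * dist u x" by (intro arccos_inner_le_dist u) simp
    then show "x \<in> cap u \<phi>" using x by (simp add: cap_def)
  qed
  then have "prob (sphere 0 1 \<inter> ball u (\<phi> / 2)) \<le> prob (cap u \<phi>)"
    using cap_in_sets[OF \<sigma>] u by (intro finite_measure_mono) auto
  then show ?thesis
    using measure_sphere_ball_pos[OF n \<sigma> u, of "\<phi> / 2"] \<phi> cap_measure_eq[OF \<sigma> n, of u \<phi>] u
      cap_in_sets[OF \<sigma>, of u \<phi>] by simp
qed

lemma cap_subset_inner_parallel:
  assumes K: "K \<subseteq> sphere 0 1" and u: "u \<in> inner_parallel K \<delta>" and \<delta>: "0 < \<delta>"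
  shows "cap u (\<delta> / 2) \<subseteq> inner_parallel K (\<delta> / 2)"
proof
  fix x assume x: "x \<in> cap u (\<delta> / 2)"
  have u1: "norm u = 1" and uK: "cap u \<delta> \<subseteq> K" using u K by (auto simp: inner_parallel_def)
  have x1: "norm x = 1" "arccos (u \<bullet> x) \<le> \<delta> / 2" using x by (auto simp: cap_def)
  have "y \<in> cap u \<delta>" if "y \<in> cap x (\<delta> / 2)" for y
    using that arccos_inner_triangle[of u x y] u1 x1 by (simp add: cap_def)
  moreover have "x \<in> cap u \<delta>" using x1 \<delta> by (simp add: cap_def)
  ultimately show "x \<in> inner_parallel K (\<delta> / 2)" using uK by (auto simp: inner_parallel_def)
qed

lemma rotation_transpose_cancel:
  assumes "rotation_matrix (A :: real^'n^'n)"
  shows "transpose A *v (A *v x) = x"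
  using assms by (simp add: rotation_matrix_def orthogonal_matrix_def matrix_vector_mul_assoc del: transpose_matrix_vector)

text \<open>For a random rotation, the expected number of points of \<open>W\<close> taken into \<open>L\<close> is \<open>\<sigma> L\<close> times the
  size of \<open>W\<close>; some rotation attains the expectation.\<close>
lemma rotation_hits_many:
  fixes \<sigma> :: "(real^'n) measure"
  assumes n: "2 \<le> CARD('n)" and \<sigma>: "haar_sphere \<sigma>" and L: "L \<in> sets \<sigma>"
    and W: "finite W" "W \<subseteq> sphere 0 1"
  obtains A where "rotation_matrix A" "measure \<sigma> L * card W \<le> card (W \<inter> {v. A *v v \<in> L})"
proof -
  obtain \<mu> :: "(real^'n^'n) measure"
    where \<mu>: "prob_space \<mu>" "sets \<mu> = sets borel" "AE A in \<mu>. rotation_matrix A"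
      "\<And>B. rotation_matrix B \<Longrightarrow> distr \<mu> \<mu> (\<lambda>A. A ** B) = \<mu>"
    using ex_invariant_rotation_measure[where 'n='n] by blast
  interpret prob_space \<mu> by fact
  define f :: "real^'n^'n \<Rightarrow> real" where "f A = (\<Sum>v\<in>W. indicator {A. A *v v \<in> L} A)" for A
  have f: "f A = card (W \<inter> {v. A *v v \<in> L})" for A
    using W(1) by (simp add: f_def indicator_def sum.If_cases)
  have v: "{A. A *v v \<in> L} \<in> sets \<mu>" "measure \<mu> {A. A *v v \<in> L} = measure \<sigma> L" if "v \<in> W" for v
    using measure_rotations_into[OF n \<sigma> \<mu> L, of v] that W(2) by (auto simp: measure_def)
  have "integrable \<mu> f"
    unfolding f_def using v(1) by (intro Bochner_Integration.integrable_sum integrable_real_indicator) (auto simp: less_top[symmetric])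
  have int: "expectation f = measure \<sigma> L * card W"
  proof -
    have "expectation f = (\<Sum>v\<in>W. expectation (indicator {A. A *v v \<in> L}))"
      unfolding f_def using v(1) by (intro Bochner_Integration.integral_sum integrable_real_indicator) (auto simp: less_top[symmetric])
    also have "\<dots> = (\<Sum>v\<in>W. measure \<sigma> L)" using v by (intro sum.cong) auto
    finally show ?thesis by simp
  qed
  have "\<exists>A. rotation_matrix A \<and> measure \<sigma> L * card W \<le> f A"
  proof (rule ccontr)
    assume "\<not> ?thesis"
    then have "AE A in \<mu>. f A < measure \<sigma> L * card W"
      using \<mu>(3) by (auto elim!: eventually_mono simp: not_le)
    then have "expectation f < measure \<sigma> L * card W"
      by (rule expectation_less[OF \<open>integrable \<mu> f\<close>])
    then show False using int by simp
  qed
  then show ?thesis using that f by auto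
qed

text \<open>Let \<open>V\<close> be a net as provided by \<open>finite_maximal_disjoint\<close> for caps of radius \<open>\<delta> / 2\<close>. If rotated
  copies of \<open>inner_parallel K \<delta>\<close> cover \<open>V\<close>, then the same copies of \<open>K\<close> cover the sphere, as each
  point has angle at most \<open>\<delta>\<close> to \<open>V\<close>. The greedy bound applies to \<open>V\<close>: \<open>rotation_hits_many\<close> supplies
  the density, and one copy contains at most as many points of \<open>V\<close> as there is room for their
  disjoint caps of radius \<open>\<delta> / 2\<close> in \<open>inner_parallel K (\<delta> / 2)\<close>.\<close>
lemma covering_by_rotated_copies:
  fixes \<sigma> :: "(real^'n) measure"
  assumes n: "2 \<le> CARD('n)" and \<sigma>: "haar_sphere \<sigma>" and K: "K \<in> sets (completion \<sigma>)"
    and \<delta>: "0 < \<delta>" and p: "0 < measure (completion \<sigma>) (inner_parallel K \<delta>)"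
  shows "\<exists>(N::nat) (A :: nat \<Rightarrow> real^'n^'n). (\<forall>i<N. rotation_matrix (A i)) \<and>
      sphere 0 1 \<subseteq> (\<Union>i<N. (\<lambda>x. A i *v x) ` K) \<and>
      real N * measure (completion \<sigma>) K \<le>
        measure (completion \<sigma>) K / measure (completion \<sigma>) (inner_parallel K \<delta>) *
            (1 + ln (measure (completion \<sigma>) (inner_parallel K (\<delta> / 2)) / cap_measure \<sigma> (\<delta> / 2)))"
proof -
  interpret prob_space \<sigma> using \<sigma> by (simp add: haar_sphere_def)
  interpret c: prob_space "completion \<sigma>" by (rule prob_space_completion)
  have KS: "K \<subseteq> sphere 0 1"
    using sets.sets_into_space[OF K] haar_sphere_space[OF \<sigma>] by simp
  let ?p = "measure (completion \<sigma>) (inner_parallel K \<delta>)"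
  let ?m = "measure (completion \<sigma>) (inner_parallel K (\<delta> / 2))"
  let ?c = "cap_measure \<sigma> (\<delta> / 2)"
  have Lc: "inner_parallel K \<delta> \<in> sets (completion \<sigma>)" by (rule inner_parallel_in_sets[OF n \<sigma> K \<delta>])
  \<comment> \<open>The distribution of \<open>A *v v\<close> is known on the sets of \<open>\<sigma>\<close> only, so the inner parallel body is
    replaced by a subset of full measure that is measurable without completion.\<close>
  define L where "L = main_part \<sigma> (inner_parallel K \<delta>)"
  have L: "L \<in> sets \<sigma>" "L \<subseteq> inner_parallel K \<delta>" "measure \<sigma> L = ?p"
    using Lc main_part_null_part_Un[OF Lc] by (auto simp: L_def measure_def simp del: main_part_null_part_Un)
  have c0: "0 < ?c" using cap_measure_pos[OF n \<sigma>] \<delta> by simp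
  have c: "prob (cap v (\<delta> / 2)) = ?c" if "norm v = 1" for v
    using cap_measure_eq[OF \<sigma> n, of v "\<delta> / 2"] cap_in_sets[OF \<sigma>, of v "\<delta> / 2"] that by simp
  have c_le: "?c \<le> prob (cap v (\<delta> / 2))" if "v \<in> sphere 0 1" for v
    using c[of v] that by simp
  have "\<exists>V\<subseteq>sphere 0 1 :: (real^'n) set. finite V \<and> disjoint_family_on (\<lambda>v. cap v (\<delta> / 2)) V \<and>
      (\<forall>x\<in>sphere 0 1. \<exists>v\<in>V. cap x (\<delta> / 2) \<inter> cap v (\<delta> / 2) \<noteq> {})"
    by (intro finite_maximal_disjoint[OF c0] cap_in_sets[OF \<sigma>] c_le)
  then obtain V :: "(real^'n) set" where V: "V \<subseteq> sphere 0 1" "finite V" "disjoint_family_on (\<lambda>v. cap v (\<delta> / 2)) V"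
      and V_max: "\<forall>x\<in>sphere 0 1 :: (real^'n) set. \<exists>v\<in>V. cap x (\<delta> / 2) \<inter> cap v (\<delta> / 2) \<noteq> {}"
    by blast
  obtain u :: "real^'n" where "norm u = 1" using vector_choose_size[of 1] by auto
  then have "V \<noteq> {}" using V_max by fastforce
  let ?S = "\<lambda>A. {v. A *v v \<in> L}" and ?I = "{A :: real^'n^'n. rotation_matrix A}"
  have avg: "\<exists>A\<in>?I. ?p * card W \<le> card (W \<inter> ?S A)" if "finite W" "W \<subseteq> V" for W
    using rotation_hits_many[OF n \<sigma> L(1) that(1)] that(2) V(1) L(3) by (metis mem_Collect_eq order_trans)
  have packing: "card (V \<inter> ?S A) * ?c \<le> ?m" if A: "rotation_matrix A" for A
  proof -
    let ?B = "\<lambda>v. cap (A *v v) (\<delta> / 2)"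
    have V1: "norm v = 1" if "v \<in> V" for v using that V(1) by auto
    have B: "?B v \<in> sets \<sigma>" "prob (?B v) = ?c" if "v \<in> V" for v
      using cap_in_sets[OF \<sigma>] c[of "A *v v"] V1[OF that] by (auto simp: norm_rotation[OF A])
    have "disjoint_family_on ?B (V \<inter> ?S A)"
      unfolding disjoint_family_on_def
    proof (intro ballI impI)
      fix v w assume vw: "v \<in> V \<inter> ?S A" "w \<in> V \<inter> ?S A" "v \<noteq> w"
      have "transpose A *v x \<in> cap v (\<delta> / 2)" if "x \<in> ?B v" for x v
        using that rotation_inner[OF rotation_matrix_transpose[OF A], of "A *v v" x]
          norm_rotation[OF rotation_matrix_transpose[OF A], of x]
        by (simp add: cap_def rotation_transpose_cancel[OF A] del: transpose_matrix_vector)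
      then have "\<exists>y. y \<in> cap v (\<delta> / 2) \<and> y \<in> cap w (\<delta> / 2)" if "x \<in> ?B v \<inter> ?B w" for x
        using that by blast
      moreover have "cap v (\<delta> / 2) \<inter> cap w (\<delta> / 2) = {}"
        using V(3) vw by (simp add: disjoint_family_on_def)
      ultimately show "?B v \<inter> ?B w = {}" by blast
    qed
    then have "(\<Sum>v\<in>V \<inter> ?S A. prob (?B v)) = prob (\<Union>v\<in>V \<inter> ?S A. ?B v)"
      using V(2) B(1) by (intro finite_measure_finite_Union[symmetric]) auto
    also have "\<dots> = measure (completion \<sigma>) (\<Union>v\<in>V \<inter> ?S A. ?B v)"
      using V(2) B(1) by (intro measure_completion[symmetric] sets.finite_UN) auto
    also have "\<dots> \<le> ?m"
      using cap_subset_inner_parallel[OF KS _ \<delta>] L(2) \<delta>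
      by (intro c.finite_measure_mono inner_parallel_in_sets[OF n \<sigma> K]) auto
    finally show ?thesis using B(2) by simp
  qed
  let ?D = "Max ((\<lambda>A. card (V \<inter> ?S A)) ` ?I)"
  have fin: "finite ((\<lambda>A. card (V \<inter> ?S A)) ` ?I)"
    by (rule finite_subset[of _ "{..card V}"]) (auto intro: card_mono[OF V(2) Int_lower1])
  have leD: "card (V \<inter> ?S A) \<le> ?D" if "A \<in> ?I" for A
    using fin that by (intro Max_ge) auto
  obtain A0 where A0: "A0 \<in> ?I" "?p * card V \<le> card (V \<inter> ?S A0)" using avg[OF V(2)] by blast
  have pV: "?p * card V \<le> ?D" using A0 leD[OF A0(1)] by linarith
  moreover have "0 < ?p * card V" using p \<open>V \<noteq> {}\<close> V(2) by (simp add: card_gt_0_iff)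
  ultimately have D0: "0 < ?D" by linarith
  have "?D \<in> (\<lambda>A. card (V \<inter> ?S A)) ` ?I" using fin A0(1) by (intro Max_in) auto
  then have Dm: "?D \<le> ?m / ?c" using packing c0 by (auto simp: pos_le_divide_eq)
  have "\<exists>J. finite J \<and> J \<subseteq> ?I \<and> V \<subseteq> (\<Union>A\<in>J. ?S A) \<and> card J \<le> card V / ?D + ln ?D / ?p"
    by (rule greedy_cover[OF p _ V(2) _ D0]) (erule (1) avg, erule leD)
  then obtain J where J: "finite J" "J \<subseteq> ?I" "V \<subseteq> (\<Union>A\<in>J. ?S A)" "card J \<le> card V / ?D + ln ?D / ?p"
    by blast
  have "card V / ?D \<le> 1 / ?p" using pV p D0 by (simp add: field_simps)
  moreover have "ln ?D / ?p \<le> ln (?m / ?c) / ?p"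
    using D0 Dm p by (intro divide_right_mono ln_mono) auto
  ultimately have card: "card J \<le> (1 + ln (?m / ?c)) / ?p" using J(4) by (simp add: add_divide_distrib)
  obtain g where g: "bij_betw g {..<card J} J"
    using ex_bij_betw_nat_finite[OF J(1)] by (auto simp: atLeast0LessThan)
  show ?thesis
  proof (intro exI conjI allI impI)
    show "rotation_matrix (transpose (g i))" if "i < card J" for i
      using that J(2) bij_betwE[OF g] by (auto intro!: rotation_matrix_transpose)
    show "sphere 0 1 \<subseteq> (\<Union>i<card J. (\<lambda>x. transpose (g i) *v x) ` K)"
    proof
      fix x :: "real^'n" assume x: "x \<in> sphere 0 1"
      obtain v y where v: "v \<in> V" and y: "y \<in> cap x (\<delta> / 2)" "y \<in> cap v (\<delta> / 2)" using V_max x by blast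
      have "arccos (v \<bullet> x) \<le> arccos (v \<bullet> y) + arccos (y \<bullet> x)"
        using v V(1) x y by (intro arccos_inner_triangle) (auto simp: cap_def)
      then have vx: "arccos (v \<bullet> x) \<le> \<delta>" using y by (simp add: cap_def inner_commute)
      obtain A where A: "A \<in> J" "A *v v \<in> L" using J(3) v by blast
      moreover have "A \<in> g ` {..<card J}" using A(1) g by (simp add: bij_betw_def)
      ultimately obtain i where i: "i < card J" "g i *v v \<in> L" "rotation_matrix (g i)"
        using J(2) by blast
      have "cap (g i *v v) \<delta> \<subseteq> K" using i(2) L(2) by (auto simp: inner_parallel_def)
      moreover have "g i *v x \<in> cap (g i *v v) \<delta>"
        using vx x by (simp add: cap_def norm_rotation[OF i(3)] rotation_inner[OF i(3)])
      ultimately have "g i *v x \<in> K" by blast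
      then show "x \<in> (\<Union>i<card J. (\<lambda>x. transpose (g i) *v x) ` K)"
        using i(1) rotation_transpose_cancel[OF i(3), of x] by (metis UN_I image_eqI lessThan_iff)
    qed
    show "real (card J) * measure (completion \<sigma>) K \<le>
        measure (completion \<sigma>) K / ?p * (1 + ln (?m / ?c))"
      using mult_right_mono[OF card measure_nonneg[of "completion \<sigma>" K]] by (simp add: mult.commute)
  qed
qed

theorem theorem1p4:
  fixes \<sigma> :: "(real ^ 'n) measure" and K :: "(real ^ 'n) set"
  assumes "2 \<le> CARD('n)"
    and "haar_sphere \<sigma>"
    and "K \<in> sets (completion \<sigma>)"
    and "\<exists>\<delta>>0. measure (completion \<sigma>) (inner_parallel K \<delta>) > 0"
  shows "\<exists>(N::nat) (A :: nat \<Rightarrow> real ^ 'n ^ 'n).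
      (\<forall>i<N. rotation_matrix (A i)) \<and>
      sphere 0 1 \<subseteq> (\<Union>i<N. (\<lambda>x. A i *v x) ` K) \<and>
      ereal (real N * measure (completion \<sigma>) K) \<le>
        (INF \<delta>\<in>{\<delta>. \<delta> > 0 \<and> measure (completion \<sigma>) (inner_parallel K \<delta>) > 0}.
          ereal (measure (completion \<sigma>) K / measure (completion \<sigma>) (inner_parallel K \<delta>) *
            (1 + ln (measure (completion \<sigma>) (inner_parallel K (\<delta> / 2)) / cap_measure \<sigma> (\<delta> / 2)))))"
proof -
  define P where "P N A \<longleftrightarrow> (\<forall>i<N. rotation_matrix (A i)) \<and>
      sphere 0 1 \<subseteq> (\<Union>i<N. (\<lambda>x. A i *v x) ` K)" for N and A :: "nat \<Rightarrow> real ^ 'n ^ 'n"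
  \<comment> \<open>The infimum need not be attained at any \<open>\<delta>\<close>, but a covering with the fewest copies is at least
    as good as the covering constructed for each \<open>\<delta>\<close>.\<close>
  define N where "N = (LEAST N. \<exists>A. P N A)"
  note cover = covering_by_rotated_copies[OF assms(1-3)]
  obtain \<delta> where "0 < \<delta>" "0 < measure (completion \<sigma>) (inner_parallel K \<delta>)" using assms(4) by blast
  from cover[OF this] have "\<exists>N A. P N A" unfolding P_def by blast
  then have "\<exists>A. P N A" unfolding N_def by (rule LeastI_ex)
  then obtain A where A: "P N A" by blast
  have "real N * measure (completion \<sigma>) K \<le>
      measure (completion \<sigma>) K / measure (completion \<sigma>) (inner_parallel K \<delta>) *
      (1 + ln (measure (completion \<sigma>) (inner_parallel K (\<delta> / 2)) / cap_measure \<sigma> (\<delta> / 2)))"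
    if \<delta>: "0 < \<delta>" "0 < measure (completion \<sigma>) (inner_parallel K \<delta>)" for \<delta>
  proof -
    obtain M B where M: "P M B" "real M * measure (completion \<sigma>) K \<le>
        measure (completion \<sigma>) K / measure (completion \<sigma>) (inner_parallel K \<delta>) *
        (1 + ln (measure (completion \<sigma>) (inner_parallel K (\<delta> / 2)) / cap_measure \<sigma> (\<delta> / 2)))"
      using cover[OF \<delta>] unfolding P_def by blast
    have "N \<le> M" unfolding N_def using M(1) by (intro Least_le) blast
    then have "real N * measure (completion \<sigma>) K \<le> real M * measure (completion \<sigma>) K"
      by (intro mult_right_mono) auto
    then show ?thesis using M(2) by linarith
  qed
  then show ?thesis using A unfolding P_def
    by (intro exI[of _ N] exI[of _ A] conjI INF_greatest) auto
qed

end
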